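(* Let $G$ be a bounded-degree Borel graph of subexponential growth on a standard Borel space $X$. Then $G$ admits a Borel unfriendly coloring; that is, there is a Borel function $c: X\to\{0,1\}$ such that for every $x\in X$, $|\{y\in G_x : c(x)\ne c(y)\}|\ge|\{y\in G_x : c(x)=c(y)\}|$.
   Context: A Borel graph $G$ on a standard Borel space $X$ is a simple undirected graph with vertex set $X$ whose edge relation (a symmetric irreflexive subset of $X\times X$, also denoted $G$) is Borel. For $x\in X$, $G_x=\{y\in X : (x,y)\in G\}$ is the set of $G$-neighbors of $x$. $G$ has bounded degree if there is $d\in\mathbb{N}$ with $|G_x|\le d$ for all $x\in X$. Let $\delta$ denote the graph metric of $G$ on its connected components. $G$ has subexponential growth if for every $x\in X$, $\lim_{r\to\infty}\frac1r\log|\{y : \delta(x,y)\le r\}|=0$, where $y$ ranges over the connected component of $x$. *)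

theory Defs
  imports "HOL-Analysis.Analysis"
begin

definition polish_topology :: "'a topology \<Rightarrow> bool" where
  "polish_topology T \<longleftrightarrow>
     completely_metrizable_space T \<and>
     (\<exists>D. countable D \<and> D \<subseteq> topspace T \<and> T closure_of D = topspace T)"

definition standard_borel_space :: "'a measure \<Rightarrow> bool" where
  "standard_borel_space M \<longleftrightarrow>
     (\<exists>T. polish_topology T \<and> topspace T = space M \<and>
          sets M = sigma_sets (space M) {U. openin T U})"

text \<open>A graph is identified with its edge relation. Membership in the product sigma-algebra
  entails that the relation is contained in \<open>space M \<times> space M\<close>; on a standard Borel
  space this sigma-algebra is that of the Borel subsets of the product.\<close>

definition borel_graph :: "'a measure \<Rightarrow> 'a rel \<Rightarrow> bool" where
  "borel_graph M G \<longleftrightarrow> G \<in> sets (M \<Otimes>\<^sub>M M) \<and> sym G \<and> irrefl G"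

definition nbrs :: "'a rel \<Rightarrow> 'a \<Rightarrow> 'a set" where
  "nbrs G x = {y. (x, y) \<in> G}"

text \<open>Finiteness is explicit here and in \<open>subexponential_growth\<close> below, as \<open>card\<close> is \<open>0\<close>
  on infinite sets.\<close>

definition bounded_degree :: "'a measure \<Rightarrow> 'a rel \<Rightarrow> bool" where
  "bounded_degree M G \<longleftrightarrow>
     (\<exists>d::nat. \<forall>x\<in>space M. finite (nbrs G x) \<and> card (nbrs G x) \<le> d)"

text \<open>The least length of a walk; meaningful only for points of the same component.\<close>

definition graph_dist :: "'a rel \<Rightarrow> 'a \<Rightarrow> 'a \<Rightarrow> nat" where
  "graph_dist G x y = (LEAST n. (x, y) \<in> G ^^ n)"

definition graph_ball :: "'a rel \<Rightarrow> 'a \<Rightarrow> nat \<Rightarrow> 'a set" where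
  "graph_ball G x r = {y. (x, y) \<in> G\<^sup>* \<and> graph_dist G x y \<le> r}"

definition subexponential_growth :: "'a measure \<Rightarrow> 'a rel \<Rightarrow> bool" where
  "subexponential_growth M G \<longleftrightarrow>
     (\<forall>x\<in>space M.
        (\<forall>r. finite (graph_ball G x r)) \<and>
        (\<lambda>r. 1 / real r * ln (real (card (graph_ball G x r)))) \<longlonglongrightarrow> 0)"

definition unfriendly_coloring :: "'a measure \<Rightarrow> 'a rel \<Rightarrow> ('a \<Rightarrow> nat) \<Rightarrow> bool" where
  "unfriendly_coloring M G c \<longleftrightarrow>
     (\<forall>x\<in>space M.
        card {y \<in> nbrs G x. c x \<noteq> c y} \<ge> card {y \<in> nbrs G x. c x = c y})"

end

theory Submission
  imports Defs
begin

text \<open>Start from a constant coloring and flip, at stage \<open>n\<close>, all currently unhappy vertices of the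
  independent Borel set \<open>A\<^sub>n\<close>, where every vertex belongs to infinitely many \<open>A\<^sub>n\<close>. Fix \<open>x\<close> and
  give the edge \<open>yz\<close> the weight \<open>q\<close> to the power \<open>\<delta>(x,y) + \<delta>(x,z)\<close> with \<open>q < 1\<close>. By
  subexponential growth the monochromatic edges have finite total weight; if \<open>q\<close> is close
  enough to \<open>1\<close> in terms of the degree bound, every flip lowers this total, and a flip at \<open>x\<close> lowers
  it by a fixed amount. So each vertex flips finitely often, and the limit coloring is unfriendly.

  Measurability of each stage needs that projections of Borel sets with boundedly many points in
  each section are Borel. This is derived from the Lusin--Souslin theorem on the Baire
  space \<open>nat \<Rightarrow> nat\<close>.\<close>

text \<open>A plain count of monochromatic edges may be infinite, and discounting by distance
  distorts local majorities: weights of neighbors differ by factors between \<open>q\<close> and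
  \<open>1/q\<close>. An unhappy vertex, however, has a surplus of at least one neighbor of its own
  color, and with at most \<open>d\<close> neighbors the distortion costs at most
  \<open>d * (1/q - q)\<close> times its weight. So \<open>q\<close> depends on \<open>d\<close>
  alone, and growth enters afterwards, to make the sum converge. The potential and its convergence
  vary with \<open>x\<close>; this is harmless, as only the flipping rule has to be Borel.
  Independence prevents both ends of an edge from flipping together, so the surplus counted before a
  stage is what the stage gains, even if infinitely many vertices flip at once. Unhappiness compares
  numbers of neighbors in Borel sets. Such counts hide an existential quantifier over points, which
  in general leads to analytic sets; bounded sections can be listed injectively, and injective
  images stay Borel.\<close>

subsection \<open>Lusin separation and injective images in the Baire space\<close>

text \<open>Needed because \<open>nat\<close> is not an instance of \<open>metric_space\<close>, so that the metric on function
  spaces does not yield the Hausdorff property of \<open>nat \<Rightarrow> nat\<close>.\<close>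

lemma open_vimage_coordinate: "open W \<Longrightarrow> open ((\<lambda>h :: 'a \<Rightarrow> 'b::topological_space. h i) -` W)"
  by (rule open_vimage[OF _ continuous_on_product_coordinates])

instance "fun" :: (type, t0_space) t0_space
proof
  fix f g :: "'a \<Rightarrow> 'b"
  assume "f \<noteq> g"
  then obtain i where i: "f i \<noteq> g i" by blast
  obtain U where "open U" "(f i \<in> U) \<noteq> (g i \<in> U)" using Topological_Spaces.t0_space[OF i] by blast
  then show "\<exists>U. open U \<and> (f \<in> U) \<noteq> (g \<in> U)"
    by (intro exI[of _ "(\<lambda>h. h i) -` U"]) (simp add: open_vimage_coordinate)
qed

instance "fun" :: (type, t1_space) t1_space
proof
  fix f g :: "'a \<Rightarrow> 'b"
  assume "f \<noteq> g"
  then obtain i where "f i \<noteq> g i" by blast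
  then obtain U where "open U" "f i \<in> U" "g i \<notin> U" by (meson t1_space)
  then show "\<exists>U. open U \<and> f \<in> U \<and> g \<notin> U"
    by (intro exI[of _ "(\<lambda>h. h i) -` U"]) (simp add: open_vimage_coordinate)
qed

instance "fun" :: (type, t2_space) t2_space
proof
  fix f g :: "'a \<Rightarrow> 'b"
  assume "f \<noteq> g"
  then obtain i where "f i \<noteq> g i" by blast
  then obtain U V where "open U" "open V" "f i \<in> U" "g i \<in> V" "U \<inter> V = {}"
    by (meson hausdorff)
  then show "\<exists>U V. open U \<and> open V \<and> f \<in> U \<and> g \<in> V \<and> U \<inter> V = {}"
    by (intro exI[of _ "(\<lambda>h. h i) -` U"] exI[of _ "(\<lambda>h. h i) -` V"])
      (auto simp: open_vimage_coordinate)
qed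

section \<open>Cylinders and branches in the Baire space\<close>

definition cylinder :: "nat list \<Rightarrow> (nat \<Rightarrow> nat) set" where
  "cylinder s = {w. \<forall>i<length s. w i = s ! i}"

lemma cylinder_Nil [simp]: "cylinder [] = UNIV"
  by (simp add: cylinder_def)

lemma in_cylinder_map_upt: "v \<in> cylinder (map w [0..<n]) \<longleftrightarrow> (\<forall>i<n. v i = w i)"
  by (simp add: cylinder_def)

lemma cylinder_UN_append: "cylinder s = (\<Union>i. cylinder (s @ [i]))"
proof -
  have "w \<in> cylinder (s @ [i]) \<longleftrightarrow> w \<in> cylinder s \<and> w (length s) = i" for w i
    by (auto simp: cylinder_def nth_append less_Suc_eq)
  then show ?thesis by blast
qed

lemma cylinder_disjoint:
  assumes "length s = length t" "s \<noteq> t"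
  shows "cylinder s \<inter> cylinder t = {}"
proof -
  obtain i where "i < length s" "s ! i \<noteq> t ! i"
    using assms nth_equalityI by blast
  then show ?thesis using assms(1) by (auto simp: cylinder_def)
qed

lemma open_coordinate: "open {w :: nat \<Rightarrow> nat. w n \<in> A}"
  using open_vimage_coordinate[OF open_discrete, of n A] by (simp add: vimage_def)

lemma borel_coordinate: "{w :: nat \<Rightarrow> nat. w n \<in> A} \<in> sets borel"
  by (intro borel_open open_coordinate)

lemma open_cylinder: "open (cylinder s)"
proof -
  have "cylinder s = (\<Inter>i\<in>{..<length s}. {w. w i \<in> {s ! i}})"
    by (auto simp: cylinder_def)
  then show ?thesis by (simp only:) (intro open_INT ballI open_coordinate finite_lessThan)
qed

lemma open_contains_cylinder:
  assumes "open U" "w \<in> U"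
  shows "\<exists>n. cylinder (map w [0..<n]) \<subseteq> U"
proof -
  obtain X where X: "w \<in> (\<Pi>\<^sub>E i\<in>UNIV. X i)" "finite {i. X i \<noteq> UNIV}" "(\<Pi>\<^sub>E i\<in>UNIV. X i) \<subseteq> U"
    using product_topology_open_contains_basis[of "\<lambda>_. euclidean" UNIV U w] assms
    by (auto simp: open_fun_def)
  obtain n where n: "\<forall>i\<in>{i. X i \<noteq> UNIV}. i < n"
    using finite_nat_set_iff_bounded X(2) by blast
  have "cylinder (map w [0..<n]) \<subseteq> (\<Pi>\<^sub>E i\<in>UNIV. X i)"
  proof
    fix v assume v: "v \<in> cylinder (map w [0..<n])"
    have "v i \<in> X i" for i
      using v n X(1) by (cases "i < n") (auto simp: in_cylinder_map_upt PiE_iff)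
    then show "v \<in> (\<Pi>\<^sub>E i\<in>UNIV. X i)" by auto
  qed
  then show ?thesis using X(3) by blast
qed

lemma closed_meets_cylinders:
  assumes "closed E" "\<And>n. E \<inter> cylinder (map w [0..<n]) \<noteq> {}"
  shows "w \<in> E"
proof (rule ccontr)
  assume "w \<notin> E"
  then obtain n where "cylinder (map w [0..<n]) \<subseteq> - E"
    using open_contains_cylinder[of "- E" w] assms(1) by auto
  then show False using assms(2) by blast
qed

lemma continuous_image_cylinder_subset:
  assumes "continuous_on UNIV f" "open U" "f w \<in> U"
  shows "\<exists>n. f ` cylinder (map w [0..<n]) \<subseteq> U"
proof -
  have "open (f -` U)" using assms(1,2) by (rule open_vimage[rotated])
  then show ?thesis using open_contains_cylinder[of "f -` U" w] assms(3) by blast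
qed

text \<open>Dependent choice in a tree without dead ends. The letters may have any type, so that
  with pairs as letters two sequences grow in step.\<close>

lemma infinite_branch:
  assumes "P []" and step: "\<And>s. P s \<Longrightarrow> \<exists>i. P (s @ [i])"
  shows "\<exists>w. \<forall>n. P (map w [0..<n])"
proof -
  have "\<exists>S. \<forall>n. (P (S n) \<and> length (S n) = n) \<and> (\<exists>i. S (Suc n) = S n @ [i])"
  proof (rule dependent_nat_choice)
    fix s n assume "P s \<and> length s = n"
    then show "\<exists>t. (P t \<and> length t = Suc n) \<and> (\<exists>i. t = s @ [i])"
      using step[of s] by auto
  qed (use assms(1) in auto)
  then obtain S where S: "\<And>n. P (S n)" "\<And>n. length (S n) = n" "\<And>n. \<exists>i. S (Suc n) = S n @ [i]"
    by blast
  have "map (\<lambda>n. S (Suc n) ! n) [0..<n] = S n" for n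
  proof (induction n)
    case 0
    then show ?case using S(2)[of 0] by simp
  next
    case (Suc n)
    then show ?case using S(2)[of n] S(3)[of n] by (auto simp: nth_append)
  qed
  then show ?thesis using S(1) by metis
qed

section \<open>Separation by Borel sets\<close>

definition borel_separated :: "'b::topological_space set \<Rightarrow> 'b set \<Rightarrow> bool" where
  "borel_separated A B \<longleftrightarrow> (\<exists>C\<in>sets borel. A \<subseteq> C \<and> B \<inter> C = {})"

text \<open>Used in contrapositive form: if two countable unions cannot be separated, then some pair
  of pieces cannot. In the separator, \<open>A i\<close> lies in every \<open>C i j\<close>, while
  \<open>B j\<close> misses \<open>C i j\<close> for every \<open>i\<close>.\<close>

lemma borel_separated_UN:
  fixes A B :: "nat \<Rightarrow> 'b::topological_space set"
  assumes "\<And>i j. borel_separated (A i) (B j)"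
  shows "borel_separated (\<Union>i. A i) (\<Union>j. B j)"
proof -
  obtain C where C: "\<And>i j. C i j \<in> sets borel" "\<And>i j. A i \<subseteq> C i j" "\<And>i j. B j \<inter> C i j = {}"
    using assms unfolding borel_separated_def by metis
  have "(\<Union>i. \<Inter>j. C i j) \<in> sets borel"
    by (intro sets.countable_UN sets.countable_INT image_subsetI C(1)) auto
  moreover have "(\<Union>i. A i) \<subseteq> (\<Union>i. \<Inter>j. C i j)" using C(2) by blast
  moreover have "(\<Union>j. B j) \<inter> (\<Union>i. \<Inter>j. C i j) = {}" using C(3) by blast
  ultimately show ?thesis unfolding borel_separated_def by blast
qed

lemma borel_separated_empty: "borel_separated {} B" "borel_separated A {}"
proof -
  show "borel_separated {} B"
    unfolding borel_separated_def by (rule bexI[of _ "{}"]) auto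
  show "borel_separated A {}"
    unfolding borel_separated_def by (rule bexI[of _ UNIV]) auto
qed

text \<open>Inseparability would pass from a pair of cylinders to a pair of longer ones, hence along
  two branches \<open>w\<close> and \<open>v\<close>. Their images differ, and by continuity
  disjoint neighborhoods of \<open>f w\<close> and \<open>g v\<close> already separate the images of
  long cylinders.\<close>

theorem lusin_separation:
  fixes f g :: "(nat \<Rightarrow> nat) \<Rightarrow> 'b::t2_space"
  assumes "closed E" "closed E'" and f: "continuous_on UNIV f" and g: "continuous_on UNIV g"
    and disj: "f ` E \<inter> g ` E' = {}"
  shows "borel_separated (f ` E) (g ` E')"
proof (rule ccontr)
  define P where "P l \<longleftrightarrow> \<not> borel_separated (f ` (E \<inter> cylinder (map fst l))) (g ` (E' \<inter> cylinder (map snd l)))"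
    for l
  assume "\<not> borel_separated (f ` E) (g ` E')"
  then have "P []" by (simp add: P_def)
  moreover have "\<exists>p. P (l @ [p])" if "P l" for l
  proof (rule ccontr)
    let ?A = "\<lambda>i. f ` (E \<inter> cylinder (map fst l @ [i]))"
    let ?B = "\<lambda>j. g ` (E' \<inter> cylinder (map snd l @ [j]))"
    assume "\<nexists>p. P (l @ [p])"
    then have "borel_separated (?A i) (?B j)" for i j
      by (auto simp: P_def)
    then have "borel_separated (\<Union>i. ?A i) (\<Union>j. ?B j)" by (rule borel_separated_UN)
    moreover have "(\<Union>i. ?A i) = f ` (E \<inter> cylinder (map fst l))"
      using cylinder_UN_append[of "map fst l"] by blast
    moreover have "(\<Union>j. ?B j) = g ` (E' \<inter> cylinder (map snd l))"
      using cylinder_UN_append[of "map snd l"] by blast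
    ultimately show False using that by (simp add: P_def)
  qed
  ultimately obtain u where u: "\<And>n. P (map u [0..<n])" using infinite_branch by metis
  define w v where "w = fst \<circ> u" and "v = snd \<circ> u"
  have nsep: "\<not> borel_separated (f ` (E \<inter> cylinder (map w [0..<n]))) (g ` (E' \<inter> cylinder (map v [0..<n])))" for n
    using u[of n] by (simp add: P_def w_def v_def)
  have "E \<inter> cylinder (map w [0..<n]) \<noteq> {}" "E' \<inter> cylinder (map v [0..<n]) \<noteq> {}" for n
    using nsep[of n] borel_separated_empty by (metis image_empty)+
  then have "w \<in> E" "v \<in> E'" using closed_meets_cylinders assms(1,2) by blast+
  then have "f w \<noteq> g v" using disj by blast
  then obtain U V where UV: "open U" "open V" "f w \<in> U" "g v \<in> V" "U \<inter> V = {}"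
    by (meson hausdorff)
  obtain m n where mn: "f ` cylinder (map w [0..<m]) \<subseteq> U" "g ` cylinder (map v [0..<n]) \<subseteq> V"
    using continuous_image_cylinder_subset f g UV by meson
  have mono: "cylinder (map w [0..<max m n]) \<subseteq> cylinder (map w [0..<m])"
    "cylinder (map v [0..<max m n]) \<subseteq> cylinder (map v [0..<n])"
    by (auto simp: in_cylinder_map_upt)
  have "borel_separated (f ` (E \<inter> cylinder (map w [0..<max m n]))) (g ` (E' \<inter> cylinder (map v [0..<max m n])))"
    unfolding borel_separated_def
  proof (intro bexI conjI)
    show "f ` (E \<inter> cylinder (map w [0..<max m n])) \<subseteq> U" using mono mn by blast
    show "g ` (E' \<inter> cylinder (map v [0..<max m n])) \<inter> U = {}" using mono mn UV(5) by blast
  qed (use UV in auto)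
  then show False using nsep by blast
qed

text \<open>Images of disjoint cylinders are disjoint by injectivity, hence enclosed in disjoint
  Borel sets \<open>B s\<close>, level by level. A point that follows these sets through all levels
  traces out a unique branch, which describes the image by countable operations.\<close>

lemma borel_injective_image_closed:
  fixes f :: "(nat \<Rightarrow> nat) \<Rightarrow> 'b::t2_space"
  assumes "closed E" and f: "continuous_on UNIV f" and inj: "inj_on f E"
  shows "f ` E \<in> sets borel"
proof -
  define A where "A s = f ` (E \<inter> cylinder s)" for s
  have "\<exists>C\<in>sets borel. A s \<subseteq> C \<and> A t \<inter> C = {}" if "length s = length t" "s \<noteq> t" for s t
  proof -
    have closed: "closed (E \<inter> cylinder r)" for r
    proof -
      have "- cylinder r = (\<Union>i\<in>{..<length r}. {w. w i \<in> - {r ! i}})"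
        by (auto simp: cylinder_def)
      then have "open (- cylinder r)" by (simp only:) (intro open_UN ballI open_coordinate)
      then have "closed (cylinder r)" by (simp add: closed_def)
      with \<open>closed E\<close> show ?thesis by (rule closed_Int)
    qed
    have "A s \<inter> A t = f ` (E \<inter> cylinder s \<inter> (E \<inter> cylinder t))"
      unfolding A_def using inj by (intro inj_on_image_Int[symmetric]) auto
    also have "\<dots> = {}" using cylinder_disjoint[OF that] by blast
    finally show ?thesis
      using lusin_separation[OF closed closed f f] by (simp add: A_def borel_separated_def)
  qed
  then obtain C where C: "\<And>s t. length s = length t \<Longrightarrow> s \<noteq> t \<Longrightarrow>
      C s t \<in> sets borel \<and> A s \<subseteq> C s t \<and> A t \<inter> C s t = {}"
    by metis
  define T where "T s = {t. length t = length s \<and> t \<noteq> s}" for s :: "nat list"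
  \<comment> \<open>\<open>C s t\<close> and \<open>C t s\<close> come from separate choices; the
    differences make sets of one level disjoint. The closure keeps points of \<open>B s\<close>
    close to \<open>A s\<close>, so that the branch of a point leads back to this point.\<close>
  define B where "B s = closure (A s) \<inter> (\<Inter>t\<in>T s. C s t - C t s)" for s
  have B_borel: "B s \<in> sets borel" for s
  proof -
    have "(\<Inter>t\<in>T s. C s t - C t s) \<in> sets borel"
    proof (cases "T s = {}")
      case False
      then show ?thesis using C by (intro sets.countable_INT'') (auto simp: T_def)
    qed simp
    then show ?thesis by (auto simp: B_def)
  qed
  have A_B: "A s \<subseteq> B s" for s
  proof -
    have "A s \<subseteq> C s t - C t s" if "t \<in> T s" for t
      using C[of s t] C[of t s] that by (auto simp: T_def)
    then show ?thesis using closure_subset[of "A s"] unfolding B_def by blast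
  qed
  have B_disj: "s = t" if "x \<in> B s" "x \<in> B t" "length s = length t" for x s t
  proof (rule ccontr)
    assume "s \<noteq> t"
    with that(3) have "t \<in> T s" "s \<in> T t" by (auto simp: T_def)
    with that(1,2) show False by (auto simp: B_def)
  qed
  \<comment> \<open>All prefixes are tested, so that by disjointness the lists for different
    \<open>n\<close> extend one another.\<close>
  have "f ` E = {x. \<forall>n. \<exists>s. length s = n \<and> (\<forall>k\<le>n. x \<in> B (take k s))}" (is "_ = ?R")
  proof
    show "f ` E \<subseteq> ?R"
    proof clarify
      fix w n assume "w \<in> E"
      then have "f w \<in> A (map w [0..<k])" for k
        by (auto simp: A_def in_cylinder_map_upt)
      then have "f w \<in> B (map w [0..<k])" for k
        using A_B by blast
      then show "\<exists>s. length s = n \<and> (\<forall>k\<le>n. f w \<in> B (take k s))"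
        by (intro exI[of _ "map w [0..<n]"]) (simp add: take_map)
    qed
    show "?R \<subseteq> f ` E"
    proof clarify
      fix x assume "\<forall>n. \<exists>s. length s = n \<and> (\<forall>k\<le>n. x \<in> B (take k s))"
      then obtain S where S: "\<And>n. length (S n) = n" "\<And>n k. k \<le> n \<Longrightarrow> x \<in> B (take k (S n))"
        by metis
      have xB: "x \<in> B (S n)" for n using S(2)[of n n] S(1)[of n] by simp
      have take: "take n (S (Suc n)) = S n" for n
        using S(2)[of n "Suc n"] S(1) by (intro B_disj[OF _ xB]) auto
      define w where "w n = S (Suc n) ! n" for n
      have w: "map w [0..<n] = S n" for n
      proof (induction n)
        case 0
        then show ?case using S(1)[of 0] by simp
      next
        case (Suc n)
        have "S (Suc n) = take n (S (Suc n)) @ [S (Suc n) ! n]"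
          using S(1)[of "Suc n"] by (metis lessI take_Suc_conv_app_nth take_all order_refl)
        then show ?case using Suc take by (simp add: w_def)
      qed
      have clo: "x \<in> closure (A (S n))" for n using xB by (simp add: B_def)
      then have "A (S n) \<noteq> {}" for n by (metis closure_empty empty_iff)
      then have "w \<in> E"
        by (intro closed_meets_cylinders[OF \<open>closed E\<close>]) (auto simp: A_def w)
      moreover have "f w = x"
      proof (rule ccontr)
        assume "f w \<noteq> x"
        then obtain U V where UV: "open U" "open V" "f w \<in> U" "x \<in> V" "U \<inter> V = {}"
          by (meson hausdorff)
        then obtain n where "f ` cylinder (S n) \<subseteq> U"
          using continuous_image_cylinder_subset[OF f UV(1,3)] w by auto
        then have "V \<inter> A (S n) = {}" using UV(5) by (auto simp: A_def)
        then show False using clo[of n] UV(2,4) open_Int_closure_eq_empty by blast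
      qed
      ultimately show "x \<in> f ` E" by blast
    qed
  qed
  also have "\<dots> = (\<Inter>n. \<Union>s\<in>{s. length s = n}. \<Inter>k\<in>{..n}. B (take k s))"
    by (rule set_eqI) (simp only: mem_Collect_eq INT_iff UN_iff UNIV_I Bex_def Ball_def atMost_iff simp_thms)
  also have "\<dots> \<in> sets borel"
    by (intro sets.countable_INT'' sets.countable_UN'' sets.finite_INT B_borel) auto
  finally show ?thesis .
qed

section \<open>Borel sets as injective continuous images of closed sets\<close>

text \<open>A coordinate of the homeomorphism between the Baire space and its countable power: a
  sequence of codes becomes one code.\<close>

definition part :: "nat \<Rightarrow> (nat \<Rightarrow> nat) \<Rightarrow> nat \<Rightarrow> nat" where
  "part i w = (\<lambda>j. w (prod_encode (i, j)))"

definition join :: "(nat \<Rightarrow> nat \<Rightarrow> nat) \<Rightarrow> nat \<Rightarrow> nat" where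
  "join v = (\<lambda>m. case prod_decode m of (i, j) \<Rightarrow> v i j)"

lemma part_join [simp]: "part i (join v) = v i"
  by (simp add: part_def join_def)

lemma join_part: "join (\<lambda>i. part i w) = w"
proof
  show "join (\<lambda>i. part i w) m = w m" for m
    using prod_decode_inverse[of m] by (simp add: part_def join_def split: prod.split)
qed

lemma part_eqI:
  assumes "\<And>i. part i v = part i w"
  shows "v = w"
proof -
  have "join (\<lambda>i. part i v) = join (\<lambda>i. part i w)" by (simp add: assms)
  then show ?thesis by (simp only: join_part)
qed

lemma continuous_part: "continuous_on UNIV (part i)"
proof (rule continuous_on_coordinatewise_then_product)
  show "continuous_on UNIV (\<lambda>w. part i w j)" for j
    unfolding part_def by (rule continuous_on_product_coordinates)
qed

lemma continuous_shift: "continuous_on UNIV (\<lambda>(w :: nat \<Rightarrow> nat) j. w (Suc j))"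
  by (rule continuous_on_coordinatewise_then_product) (rule continuous_on_product_coordinates)

text \<open>The sets \<open>A\<close> such that \<open>A\<close> and its complement are of this kind form a \<open>\<sigma>\<close>-algebra, which is why
  unions are needed for disjoint families only.\<close>

definition injective_closed_image :: "(nat \<Rightarrow> nat) set \<Rightarrow> bool" where
  "injective_closed_image A \<longleftrightarrow>
     (\<exists>E f. closed (E :: (nat \<Rightarrow> nat) set) \<and> continuous_on UNIV f \<and> inj_on f E \<and> A = f ` E)"

lemma injective_closed_image_closed: "closed A \<Longrightarrow> injective_closed_image A"
  unfolding injective_closed_image_def
  by (rule exI[of _ A], rule exI[of _ "\<lambda>w. w"]) simp

text \<open>One code consists of codes of the same point for all \<open>i\<close>. Agreement of the
  coded points is a closed condition because the target is Hausdorff, and injectivity is inherited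
  row by row.\<close>

lemma injective_closed_image_INT:
  assumes "\<And>i::nat. injective_closed_image (A i)"
  shows "injective_closed_image (\<Inter>i. A i)"
proof -
  obtain E f where E: "\<And>i. closed (E i :: (nat \<Rightarrow> nat) set)" and f: "\<And>i. continuous_on UNIV (f i)"
    and inj: "\<And>i. inj_on (f i) (E i)" and A: "\<And>i. A i = f i ` E i"
    using assms unfolding injective_closed_image_def by metis
  define E' where "E' = {w. \<forall>i. part i w \<in> E i \<and> f i (part i w) = f 0 (part 0 w)}"
  define f' where "f' w = f 0 (part 0 w)" for w
  have cont: "continuous_on UNIV (\<lambda>w. f i (part i w))" for i
    using continuous_on_compose2[OF f continuous_part] by blast
  have "closed E'"
  proof -
    have "closed {w. f i (part i w) = f 0 (part 0 w)}" for i
      by (intro closed_Collect_eq cont)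
    moreover have "closed (part i -` E i)" for i
      by (intro closed_vimage E continuous_part)
    moreover have "E' = (\<Inter>i. part i -` E i) \<inter> (\<Inter>i. {w. f i (part i w) = f 0 (part 0 w)})"
      by (auto simp: E'_def)
    ultimately show ?thesis by (auto intro!: closed_Int closed_INT)
  qed
  moreover have "continuous_on UNIV f'" unfolding f'_def by (rule cont)
  moreover have "inj_on f' E'"
  proof (rule inj_onI)
    fix v w assume vw: "v \<in> E'" "w \<in> E'" "f' v = f' w"
    have "part i v = part i w" for i
    proof (rule inj_onD[OF inj[of i]])
      have "f i (part i v) = f 0 (part 0 v)" "f i (part i w) = f 0 (part 0 w)"
        using vw(1,2) by (auto simp: E'_def)
      then show "f i (part i v) = f i (part i w)" using vw(3) by (simp add: f'_def)
    qed (use vw in \<open>auto simp: E'_def\<close>)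
    then show "v = w" by (rule part_eqI)
  qed
  moreover have "(\<Inter>i. A i) = f' ` E'"
  proof
    show "(\<Inter>i. A i) \<subseteq> f' ` E'"
    proof
      fix x assume "x \<in> (\<Inter>i. A i)"
      then have "x \<in> A i" for i by blast
      then have "x \<in> f i ` E i" for i by (simp flip: A)
      moreover define v where "v i = inv_into (E i) (f i) x" for i
      ultimately have v: "v i \<in> E i" "f i (v i) = x" for i
        by (simp_all add: inv_into_into f_inv_into_f)
      then have "join v \<in> E'" "f' (join v) = x" by (simp_all add: E'_def f'_def)
      then show "x \<in> f' ` E'" by blast
    qed
    show "f' ` E' \<subseteq> (\<Inter>i. A i)"
    proof clarify
      fix w i assume "w \<in> E'"
      then have "part i w \<in> E i" "f i (part i w) = f' w" by (simp_all add: E'_def f'_def)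
      then show "f' w \<in> A i" unfolding A by (metis imageI)
    qed
  qed
  ultimately show ?thesis unfolding injective_closed_image_def by blast
qed

text \<open>Digit 0 names the member and the tail is a code in it. Disjointness lets the image
  determine digit 0.\<close>

lemma injective_closed_image_disjoint_UN:
  assumes "\<And>i::nat. injective_closed_image (A i)" and disj: "disjoint_family A"
  shows "injective_closed_image (\<Union>i. A i)"
proof -
  obtain E f where E: "\<And>i. closed (E i :: (nat \<Rightarrow> nat) set)" and f: "\<And>i. continuous_on UNIV (f i)"
    and inj: "\<And>i. inj_on (f i) (E i)" and A: "\<And>i. A i = f i ` E i"
    using assms(1) unfolding injective_closed_image_def by metis
  define shift where "shift w j = w (Suc j)" for w :: "nat \<Rightarrow> nat" and j
  have shift: "continuous_on UNIV shift"
    using continuous_shift by (simp add: shift_def[abs_def])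
  define E' where "E' = {w. shift w \<in> E (w 0)}"
  define f' where "f' w = f (w 0) (shift w)" for w
  have "closed E'"
  proof -
    have "- E' = (\<Union>n. {w. w 0 \<in> {n}} \<inter> shift -` (- E n))" by (auto simp: E'_def)
    moreover have "open (shift -` (- E n))" for n
      using E shift by (intro open_vimage) auto
    ultimately have "open (- E')"
      by (simp only:) (intro open_UN ballI open_Int open_coordinate)
    then show ?thesis by (simp add: closed_def)
  qed
  moreover have "continuous_on UNIV f'"
  proof -
    have "open (f' -` U)" if "open U" for U
    proof -
      have "f' -` U = (\<Union>n. {w. w 0 \<in> {n}} \<inter> shift -` (f n -` U))" by (auto simp: f'_def)
      moreover have "open (shift -` (f n -` U))" for n
        using that f shift by (intro open_vimage) auto
      ultimately show ?thesis
        by (simp only:) (intro open_UN ballI open_Int open_coordinate)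
    qed
    then show ?thesis by (simp add: continuous_on_open_vimage)
  qed
  moreover have "inj_on f' E'"
  proof (rule inj_onI)
    fix v w assume vw: "v \<in> E'" "w \<in> E'" "f' v = f' w"
    from vw(1,2) have "f' v \<in> A (v 0)" "f' w \<in> A (w 0)" by (simp_all add: E'_def A f'_def)
    then have "f' v \<in> A (v 0)" "f' v \<in> A (w 0)" using vw(3) by simp_all
    then have 0: "v 0 = w 0" using disj by (auto simp: disjoint_family_on_def)
    then have "shift v = shift w"
      using vw inj_onD[OF inj[of "v 0"]] by (auto simp: E'_def f'_def)
    then have "v (Suc j) = w (Suc j)" for j by (metis shift_def)
    then show "v = w" using 0 by (metis ext not0_implies_Suc)
  qed
  moreover have "(\<Union>i. A i) = f' ` E'"
  proof
    show "(\<Union>i. A i) \<subseteq> f' ` E'"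
    proof
      fix x assume "x \<in> (\<Union>i. A i)"
      then obtain i w where w: "w \<in> E i" "x = f i w" using A by blast
      have "shift (case_nat i w) = w" by (auto simp: shift_def)
      then have "case_nat i w \<in> E'" "f' (case_nat i w) = x"
        using w by (simp_all add: E'_def f'_def)
      then show "x \<in> f' ` E'" by blast
    qed
    show "f' ` E' \<subseteq> (\<Union>i. A i)" by (auto simp: E'_def f'_def A)
  qed
  ultimately show ?thesis unfolding injective_closed_image_def by blast
qed

lemma injective_closed_image_Int:
  assumes "injective_closed_image A" "injective_closed_image B"
  shows "injective_closed_image (A \<inter> B)"
proof -
  have "A \<inter> B = (\<Inter>i::nat. if i = 0 then A else B)" by (auto split: if_splits)
  then show ?thesis using injective_closed_image_INT[of "\<lambda>i. if i = 0 then A else B"] assms by simp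
qed

lemma borel_injective_closed_image:
  assumes "A \<in> sets borel"
  shows "injective_closed_image A \<and> injective_closed_image (- A)"
proof -
  let ?S = "{{w \<in> \<Pi>\<^sub>E i\<in>UNIV. space borel. w i \<in> A} | i A. i \<in> UNIV \<and> A \<in> sets borel}
    :: (nat \<Rightarrow> nat) set set"
  have "A \<in> sigma_sets (\<Pi>\<^sub>E i\<in>UNIV. space borel) ?S"
    using assms by (simp only: sets_PiM_equal_borel[symmetric] sets_PiM_single)
  then show ?thesis
  proof induction
    case (Basic a)
    then obtain i B where a: "a = {w. w i \<in> B}" by auto
    have "closed a" "closed (- a)"
      using open_coordinate[of i B] open_coordinate[of i "- B"]
      by (auto simp: a closed_def Collect_neg_eq[symmetric])
    then show ?case using injective_closed_image_closed by blast
  next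
    case Empty
    show ?case by (simp add: injective_closed_image_closed)
  next
    case (Compl a)
    then show ?case by (simp add: Compl_eq_Diff_UNIV[symmetric])
  next
    case (Union a)
    \<comment> \<open>Disjointification intersects with complements of earlier sets; these are
      available since the induction carries both halves.\<close>
    have "injective_closed_image (a n \<inter> (\<Inter>i. if i < n then - a i else UNIV))" for n
      using Union by (intro injective_closed_image_Int injective_closed_image_INT)
        (auto simp: injective_closed_image_closed)
    moreover have "a n \<inter> (\<Inter>i. if i < n then - a i else UNIV) = disjointed a n" for n
      unfolding disjointed_def by (rule set_eqI) (simp only: Int_iff INT_iff UNIV_I Diff_iff UN_iff if_split_mem2, auto)
    ultimately have "injective_closed_image (\<Union>n. disjointed a n)"
      by (intro injective_closed_image_disjoint_UN disjoint_family_disjointed) auto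
    moreover have "injective_closed_image (\<Inter>n. - a n)"
      using Union by (intro injective_closed_image_INT) auto
    ultimately show ?case by (simp add: UN_disjointed_eq)
  qed
qed

text \<open>A Borel set is itself an injective continuous image of a closed set, so composition
  reduces this to the closed case.\<close>

theorem lusin_souslin:
  fixes g :: "(nat \<Rightarrow> nat) \<Rightarrow> 'b::t2_space"
  assumes "A \<in> sets borel" "continuous_on UNIV g" "inj_on g A"
  shows "g ` A \<in> sets borel"
proof -
  obtain E :: "(nat \<Rightarrow> nat) set" and f
    where E: "closed E" "continuous_on UNIV f" "inj_on f E" "A = f ` E"
    using borel_injective_closed_image[OF assms(1)] unfolding injective_closed_image_def by blast
  have cont: "continuous_on UNIV (\<lambda>w. g (f w))"
    by (rule continuous_on_compose2[OF assms(2) E(2)]) simp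
  have inj: "inj_on (\<lambda>w. g (f w)) E"
    using comp_inj_on[OF E(3), of g] assms(3) E(4) by (simp add: comp_def)
  show ?thesis
    using borel_injective_image_closed[OF E(1) cont inj] by (simp add: E(4) image_image)
qed

subsection \<open>Borel sets with bounded sections\<close>

text \<open>Places finitely many points in disjoint cylinders of one common length, hence under
  countably many possible labels. Serves both to order sections and to isolate a vertex from its
  neighbors.\<close>

lemma finite_separating_prefix:
  fixes S :: "(nat \<Rightarrow> nat) set"
  assumes "finite S"
  shows "\<exists>n. inj_on (\<lambda>w. map w [0..<n]) S"
proof -
  have "\<exists>N. \<forall>v\<in>S. \<forall>w\<in>S. v \<noteq> w \<longrightarrow> (\<exists>i<N. v i \<noteq> w i)"
  proof -
    define D where "D v w = (LEAST i. v i \<noteq> w i)" for v w :: "nat \<Rightarrow> nat"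
    have D: "v (D v w) \<noteq> w (D v w)" if vw: "v \<noteq> w" for v w
      proof -
      obtain i where "v i \<noteq> w i" using vw by blast
      then show ?thesis unfolding D_def by (rule LeastI)
    qed
    have "finite ((\<lambda>(v, w). D v w) ` (S \<times> S))" using assms by simp
    then obtain N where "\<forall>i\<in>(\<lambda>(v, w). D v w) ` (S \<times> S). i < N"
      using finite_nat_set_iff_bounded by blast
    then have "D v w < N" if "v \<in> S" "w \<in> S" for v w using that by auto
    then show ?thesis using D by meson
  qed
  then obtain N where N: "\<And>v w. v \<in> S \<Longrightarrow> w \<in> S \<Longrightarrow> v \<noteq> w \<Longrightarrow> \<exists>i<N. v i \<noteq> w i" by blast
  have "inj_on (\<lambda>w. map w [0..<N]) S"
  proof (rule inj_onI, rule ccontr)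
    fix v w assume vw: "v \<in> S" "w \<in> S" "v \<noteq> w" and eq: "map v [0..<N] = map w [0..<N]"
    obtain i where "i < N" "v i \<noteq> w i" using N[OF vw] by blast
    moreover have "v \<in> cylinder (map w [0..<N])"
      unfolding eq[symmetric] by (simp add: in_cylinder_map_upt)
    ultimately show False by (simp add: in_cylinder_map_upt)
  qed
  then show ?thesis by blast
qed

lemma borel_cylinder: "cylinder s \<in> sets borel"
  by (intro borel_open open_cylinder)

lemma measurable_part [measurable]: "part i \<in> borel \<rightarrow>\<^sub>M borel"
  by (intro borel_measurable_continuous_onI continuous_part)

text \<open>If all sections have at most \<open>k\<close> points, a point \<open>x\<close> with exactly \<open>k\<close> of them is
  determined by one code \<open>w\<close> listing the section in the order prescribed by disjoint cylinders,
  so that Lusin--Souslin applies to the map \<open>w \<mapsto> x\<close>.\<close>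

lemma borel_maximal_sections:
  assumes F: "F \<in> sets (borel :: ((nat \<Rightarrow> nat) \<times> (nat \<Rightarrow> nat)) measure)"
    and fin: "\<And>x. finite {y. (x, y) \<in> F}" and card: "\<And>x. card {y. (x, y) \<in> F} \<le> k"
  shows "{x. k \<le> card {y. (x, y) \<in> F}} \<in> sets borel"
proof -
  \<comment> \<open>Row 0 is the point \<open>x\<close>, row \<open>Suc i\<close> a point of its
    section. The remaining rows are frozen at 0, since otherwise \<open>x\<close> would not
    determine the code.\<close>
  define W where "W ss = {w. (\<forall>i<k. part (Suc i) w \<in> cylinder (ss ! i) \<and> (part 0 w, part (Suc i) w) \<in> F)
      \<and> (\<forall>i\<ge>k. part (Suc i) w = (\<lambda>_. 0))}" for ss
  \<comment> \<open>Equal lengths make distinct cylinders disjoint, so \<open>ss\<close> fixes the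
    order of the section; and \<open>L\<close> is countable.\<close>
  define L where "L = {ss :: nat list list. length ss = k \<and> distinct ss \<and> (\<exists>n. \<forall>s\<in>set ss. length s = n)}"
  have W_borel: "W ss \<in> sets borel" for ss
  proof -
    note [measurable] = F borel_cylinder
    have [measurable]: "{\<lambda>_. 0} \<in> sets (borel :: (nat \<Rightarrow> nat) measure)"
      by (intro borel_closed closed_singleton)
    have "(\<lambda>w. (part 0 w, part (Suc i) w)) \<in> borel \<rightarrow>\<^sub>M borel" for i
      by (intro borel_measurable_Pair measurable_part)
    note [measurable] = this
    have "W ss = {w\<in>space borel. (\<forall>i<k. part (Suc i) w \<in> cylinder (ss ! i) \<and> (part 0 w, part (Suc i) w) \<in> F)
      \<and> (\<forall>i\<ge>k. part (Suc i) w \<in> {\<lambda>_. 0})}"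
      by (auto simp: W_def)
    also have "\<dots> \<in> sets borel" by measurable
    finally show ?thesis .
  qed
  have W: "part (Suc i) w \<in> cylinder (ss ! i)" "(part 0 w, part (Suc i) w) \<in> F"
    if "w \<in> W ss" "i < k" for w ss i
    using that by (simp_all add: W_def)
  have sep: "i = j" if ss: "ss \<in> L" and ij: "i < k" "j < k"
    and y: "y \<in> cylinder (ss ! i)" "y \<in> cylinder (ss ! j)" for ss i j y
  proof -
    have "ss ! i \<in> set ss" "ss ! j \<in> set ss" using ss ij by (simp_all add: L_def)
    then have "length (ss ! i) = length (ss ! j)" using ss unfolding L_def by force
    then have "ss ! i = ss ! j" using cylinder_disjoint y by blast
    then show "i = j" using ss ij by (simp add: L_def nth_eq_iff_index_eq)
  qed
  have inj_parts: "inj_on (\<lambda>i. part (Suc i) w) {..<k}" if "ss \<in> L" "w \<in> W ss" for w ss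
  proof (rule inj_onI)
    fix i j assume "i \<in> {..<k}" "j \<in> {..<k}" "part (Suc i) w = part (Suc j) w"
    then show "i = j" using sep[OF that(1), of i j] W(1)[OF that(2)] by (metis lessThan_iff)
  qed
  have inj: "inj_on (part 0) (W ss)" if ss: "ss \<in> L" for ss
  proof (rule inj_onI)
    fix v w assume v: "v \<in> W ss" and w: "w \<in> W ss" and 0: "part 0 v = part 0 w"
    let ?S = "{y. (part 0 v, y) \<in> F}"
    have "card ((\<lambda>i. part (Suc i) v) ` {..<k}) = k"
      using card_image[OF inj_parts[OF ss v]] by simp
    moreover have "(\<lambda>i. part (Suc i) v) ` {..<k} \<subseteq> ?S" using W(2)[OF v] by auto
    \<comment> \<open>Here \<open>k\<close> distinct rows lie in a section of at most
      \<open>k\<close> points and so exhaust it.\<close>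
    ultimately have S: "(\<lambda>i. part (Suc i) v) ` {..<k} = ?S"
      using card_seteq[OF fin] card by metis
    have Suc: "part (Suc i) v = part (Suc i) w" for i
    proof (cases "i < k")
      case True
      then have "part (Suc i) w \<in> ?S" using W(2)[OF w] by (simp add: 0)
      then obtain j where j: "j < k" "part (Suc i) w = part (Suc j) v" using S by auto
      moreover have "i = j"
        using sep[OF ss True j(1)] W(1)[OF v j(1)] W(1)[OF w True] j(2) by metis
      ultimately show ?thesis by simp
    next
      case False
      then show ?thesis using v w by (simp add: W_def)
    qed
    have "part i v = part i w" for i using 0 Suc by (cases i) auto
    then show "v = w" by (rule part_eqI)
  qed
  have "{x. k \<le> card {y. (x, y) \<in> F}} = (\<Union>ss\<in>L. part 0 ` W ss)"
  proof
    show "{x. k \<le> card {y. (x, y) \<in> F}} \<subseteq> (\<Union>ss\<in>L. part 0 ` W ss)"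
    proof clarify
      fix x assume "k \<le> card {y. (x, y) \<in> F}"
      then have k: "card {y. (x, y) \<in> F} = k" using card[of x] by linarith
      obtain ys where ys: "set ys = {y. (x, y) \<in> F}" "distinct ys"
        using finite_distinct_list[OF fin] by blast
      have len: "length ys = k" using k ys distinct_card by metis
      obtain n where n: "inj_on (\<lambda>w. map w [0..<n]) (set ys)"
        using finite_separating_prefix[of "set ys"] by auto
      define ss where "ss = map (\<lambda>w. map w [0..<n]) ys"
      define w where "w = join (\<lambda>i. case i of 0 \<Rightarrow> x | Suc i \<Rightarrow> if i < k then ys ! i else (\<lambda>_. 0))"
      have "ss \<in> L" using n ys len by (auto simp: L_def ss_def distinct_map)
      moreover have "(x, ys ! i) \<in> F" if "i < k" for i
        using that ys(1) len nth_mem by blast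
      then have "w \<in> W ss"
        using len by (auto simp: W_def w_def ss_def in_cylinder_map_upt)
      moreover have "part 0 w = x" by (simp add: w_def)
      ultimately show "x \<in> (\<Union>ss\<in>L. part 0 ` W ss)" by blast
    qed
    show "(\<Union>ss\<in>L. part 0 ` W ss) \<subseteq> {x. k \<le> card {y. (x, y) \<in> F}}"
    proof clarify
      fix ss w assume ss: "ss \<in> L" and w: "w \<in> W ss"
      have "k = card ((\<lambda>i. part (Suc i) w) ` {..<k})"
        using card_image[OF inj_parts[OF ss w]] by simp
      also have "\<dots> \<le> card {y. (part 0 w, y) \<in> F}"
        using W(2)[OF w] by (intro card_mono fin) auto
      finally show "k \<le> card {y. (part 0 w, y) \<in> F}" .
    qed
  qed
  also have "\<dots> \<in> sets borel"
    by (intro sets.countable_UN'' lusin_souslin W_borel continuous_part inj) auto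
  finally show ?thesis .
qed

text \<open>Induction on the bound: the points with the maximal number \<open>Suc d\<close> form a
  Borel set \<open>D\<close>, and deleting their sections leaves a relation with bound
  \<open>d\<close>.\<close>

proposition borel_section_card:
  assumes "F \<in> sets (borel :: ((nat \<Rightarrow> nat) \<times> (nat \<Rightarrow> nat)) measure)"
    and "\<And>x. finite {y. (x, y) \<in> F}" and "\<And>x. card {y. (x, y) \<in> F} \<le> d"
  shows "{x. k \<le> card {y. (x, y) \<in> F}} \<in> sets borel"
  using assms
proof (induction d arbitrary: F)
  case 0
  then have "{x. k \<le> card {y. (x, y) \<in> F}} = (if k = 0 then UNIV else {})" by auto
  then show ?case by simp
next
  case (Suc d)
  define D where "D = {x. Suc d \<le> card {y. (x, y) \<in> F}}"
  have D: "D \<in> sets borel"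
    unfolding D_def using Suc.prems by (intro borel_maximal_sections)
  define F' where "F' = F - fst -` D"
  have sec: "{y. (x, y) \<in> F'} = (if x \<in> D then {} else {y. (x, y) \<in> F})" for x
    by (auto simp: F'_def)
  have "F' \<in> sets borel"
  proof -
    have "fst \<in> (borel :: ((nat \<Rightarrow> nat) \<times> (nat \<Rightarrow> nat)) measure) \<rightarrow>\<^sub>M borel"
      by (intro borel_measurable_continuous_onI continuous_on_fst continuous_on_id)
    from measurable_sets[OF this D] show ?thesis
      unfolding F'_def using Suc.prems(1) by (intro sets.Diff) auto
  qed
  moreover have "finite {y. (x, y) \<in> F'}" "card {y. (x, y) \<in> F'} \<le> d" for x
    using Suc.prems(2,3)[of x] by (auto simp: sec D_def)
  ultimately have IH: "{x. k \<le> card {y. (x, y) \<in> F'}} \<in> sets borel"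
    by (rule Suc.IH)
  show ?case
  proof (cases "k \<le> Suc d")
    case True
    then have "{x. k \<le> card {y. (x, y) \<in> F}} = D \<union> {x. k \<le> card {y. (x, y) \<in> F'}}"
      by (auto simp: sec D_def)
    then show ?thesis using D IH by auto
  next
    case False
    then have "{x. k \<le> card {y. (x, y) \<in> F}} = {}"
      using Suc.prems(3) by (metis (mono_tags, lifting) Collect_empty_eq le_trans)
    then show ?thesis by simp
  qed
qed

section \<open>Coding a standard Borel space in the Baire space\<close>

lemma standard_borel_coding:
  assumes "standard_borel_space M" "space M \<noteq> {}"
  obtains \<phi> :: "'a \<Rightarrow> nat \<Rightarrow> nat" and \<psi>
  where "\<phi> \<in> M \<rightarrow>\<^sub>M borel" "\<psi> \<in> borel \<rightarrow>\<^sub>M M" "\<And>x. x \<in> space M \<Longrightarrow> \<psi> (\<phi> x) = x"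
proof -
  \<comment> \<open>\<open>\<phi> x k\<close> is the first point of a dense sequence at distance less than \<open>1/2^k\<close> from \<open>x\<close>; \<open>\<psi>\<close>
    takes the limit of the coded sequence of dense points.\<close>
  obtain T where T: "polish_topology T" "topspace T = space M"
    "sets M = sigma_sets (space M) {U. openin T U}"
    using assms(1) unfolding standard_borel_space_def by blast
  obtain X d where "Metric_space X d" and complete: "Metric_space.mcomplete X d"
    and TX: "T = Metric_space.mtopology X d"
    using T(1) unfolding polish_topology_def completely_metrizable_space_def by blast
  then interpret Metric_space X d by simp
  have X: "X = space M" using T(2) TX by simp
  obtain D where D: "countable D" "D \<subseteq> X" "mtopology closure_of D = X"
    using T(1) TX unfolding polish_topology_def by auto
  have "D \<noteq> {}" using D(3) assms(2) X by auto
  define e where "e = from_nat_into D"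
  have e: "e i \<in> X" for i
    using from_nat_into[OF \<open>D \<noteq> {}\<close>] D(2) by (auto simp: e_def)
  have dense: "\<exists>i. d x (e i) < r" if "x \<in> X" "r > 0" for x r
  proof -
    from that D(3) have "\<exists>y\<in>D. y \<in> mball x r" by (auto simp: metric_closure_of)
    then obtain y where y: "y \<in> D" "d x y < r" by auto
    then show ?thesis using from_nat_into_surj[OF D(1) y(1)] by (auto simp: e_def)
  qed
  have open_M: "U \<in> sets M" if "openin mtopology U" for U
    using that by (auto simp: T(3) TX)
  define \<phi> where "\<phi> x k = (LEAST i. d (e i) x < (1/2) ^ k)" for x k
  have \<phi>: "d (e (\<phi> x k)) x < (1/2) ^ k" if x: "x \<in> X" for x k
  proof -
    obtain i where "d x (e i) < (1/2) ^ k" using dense[OF x, of "(1/2) ^ k"] by auto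
    then have "d (e i) x < (1/2) ^ k" by (simp only: commute[of "e i"])
    then show ?thesis unfolding \<phi>_def by (rule LeastI)
  qed
  have "(\<lambda>x. \<phi> x k) \<in> M \<rightarrow>\<^sub>M count_space UNIV" for k
    unfolding \<phi>_def
  proof (rule measurable_Least)
    fix i
    have "{x \<in> space M. d (e i) x < (1/2) ^ k} = mball (e i) ((1/2) ^ k)"
      unfolding X[symmetric] using e by auto
    then show "Measurable.pred M (\<lambda>x. d (e i) x < (1/2) ^ k)"
      using open_M by (simp add: pred_def)
  qed
  then have "(\<lambda>x. \<phi> x k) \<in> M \<rightarrow>\<^sub>M borel" for k
    by (simp add: measurable_cong_sets[OF refl sets_borel_eq_count_space])
  then have \<phi>_meas: "\<phi> \<in> M \<rightarrow>\<^sub>M borel" by (rule measurable_coordinatewise_then_product)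
  \<comment> \<open>By the triangle inequality every \<open>\<phi> x\<close> lies here. The bound
    gives the limit a known rate, so that membership of the limit in an open set can be read off
    single coordinates.\<close>
  define Q where "Q = {z. \<forall>k l. d (e (z k)) (e (z l)) \<le> (1/2) ^ k + (1/2) ^ l}"
  define \<psi> where
    "\<psi> z = (if z \<in> Q then SOME x. limitin mtopology (\<lambda>k. e (z k)) x sequentially else e 0)" for z
  have small: "\<exists>N. \<forall>n\<ge>N. (1/2) ^ n < \<epsilon>" if \<epsilon>: "\<epsilon> > 0" for \<epsilon> :: real
  proof -
    obtain N where "(1/2) ^ N < \<epsilon>" using real_arch_pow_inv[OF \<epsilon>, of "1/2"] by auto
    moreover have "(1/2) ^ n \<le> (1/2 :: real) ^ N" if "n \<ge> N" for n
      using that by (intro power_decreasing) auto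
    ultimately show ?thesis by (meson le_less_trans)
  qed
  have lim: "limitin mtopology (\<lambda>k. e (z k)) (\<psi> z) sequentially" if z: "z \<in> Q" for z
  proof -
    have "MCauchy (\<lambda>k. e (z k))"
      unfolding MCauchy_def
    proof (intro conjI allI impI)
      fix \<epsilon> :: real assume "\<epsilon> > 0"
      then obtain N where N: "\<And>n. n \<ge> N \<Longrightarrow> (1/2) ^ n < \<epsilon> / 2" using small[of "\<epsilon> / 2"] by auto
      have "d (e (z n)) (e (z n')) < \<epsilon>" if "N \<le> n" "N \<le> n'" for n n'
      proof -
        have "d (e (z n)) (e (z n')) \<le> (1/2) ^ n + (1/2) ^ n'" using z by (simp add: Q_def)
        then show ?thesis using N[OF that(1)] N[OF that(2)] by linarith
      qed
      then show "\<exists>N. \<forall>n n'. N \<le> n \<longrightarrow> N \<le> n' \<longrightarrow> d (e (z n)) (e (z n')) < \<epsilon>" by blast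
    qed (use e in auto)
    then have "\<exists>x. limitin mtopology (\<lambda>k. e (z k)) x sequentially"
      using complete unfolding mcomplete_def by blast
    then show ?thesis using z by (simp only: \<psi>_def if_True) (rule someI_ex)
  qed
  have \<psi>_X: "\<psi> z \<in> X" for z
  proof (cases "z \<in> Q")
    case True
    then show ?thesis using limitin_topspace[OF lim] by simp
  qed (simp add: \<psi>_def e)
  have \<psi>: "d (\<psi> z) (e (z k)) \<le> (1/2) ^ k" if z: "z \<in> Q" for z k
  proof (rule field_le_epsilon)
    fix \<epsilon> :: real assume \<epsilon>: "\<epsilon> > 0"
    then obtain N where N: "\<And>n. n \<ge> N \<Longrightarrow> (1/2) ^ n < \<epsilon> / 2" using small[of "\<epsilon> / 2"] by auto
    have "\<forall>\<^sub>F n in sequentially. e (z n) \<in> X \<and> d (e (z n)) (\<psi> z) < \<epsilon> / 2"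
      using lim[OF z] half_gt_zero[OF \<epsilon>] unfolding limitin_metric by blast
    then have "\<forall>\<^sub>F n in sequentially. d (e (z n)) (\<psi> z) < \<epsilon> / 2 \<and> n \<ge> N"
      using eventually_ge_at_top[of N] by eventually_elim auto
    then obtain n where n: "d (e (z n)) (\<psi> z) < \<epsilon> / 2" "n \<ge> N"
      using eventually_happens[of _ sequentially] by auto
    have "d (\<psi> z) (e (z k)) \<le> d (\<psi> z) (e (z n)) + d (e (z n)) (e (z k))"
      using triangle \<psi>_X e by blast
    moreover have "d (e (z n)) (e (z k)) \<le> (1/2) ^ n + (1/2) ^ k" using z by (simp add: Q_def)
    ultimately show "d (\<psi> z) (e (z k)) \<le> (1/2) ^ k + \<epsilon>"
      using n(1) N[OF n(2)] commute[of "\<psi> z" "e (z n)"] by linarith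
  qed
  have Q_borel: "Q \<in> sets borel"
  proof -
    have "Q = (\<Inter>k. \<Inter>l. \<Union>i. {z. z k \<in> {i}} \<inter>
        {z. z l \<in> {j. d (e i) (e j) \<le> (1/2) ^ k + (1/2) ^ l}})"
      by (auto simp: Q_def)
    also have "\<dots> \<in> sets borel"
      by (intro sets.countable_INT'' sets.countable_UN'' sets.Int borel_coordinate) auto
    finally show ?thesis .
  qed
  have "\<psi> \<in> borel \<rightarrow>\<^sub>M M"
  proof (rule measurable_sigma_sets[OF T(3)])
    show "{U. openin T U} \<subseteq> Pow (space M)" using openin_subset T(2) by auto
    show "\<psi> \<in> space borel \<rightarrow> space M" using \<psi>_X X by auto
    fix U assume "U \<in> {U. openin T U}"
    then have U: "openin mtopology U" using TX by simp
    \<comment> \<open>On \<open>Q\<close>, \<open>\<psi> z\<close> is within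
      \<open>(1/2) ^ k\<close> of the coded point \<open>e (z k)\<close>; doubling the radius makes
      this strict.\<close>
    let ?B = "\<lambda>k. {z. z k \<in> {i. mball (e i) (2 * (1/2) ^ k) \<subseteq> U}}"
    have inQ: "z \<in> (\<Union>k. ?B k) \<longleftrightarrow> \<psi> z \<in> U" if z: "z \<in> Q" for z
    proof
      assume "z \<in> (\<Union>k. ?B k)"
      then obtain k where "mball (e (z k)) (2 * (1/2) ^ k) \<subseteq> U" by auto
      moreover have "d (e (z k)) (\<psi> z) < 2 * (1/2) ^ k"
        using \<psi>[OF z, of k] commute[of "e (z k)" "\<psi> z"] zero_less_power[of "1/2 :: real" k] by linarith
      ultimately show "\<psi> z \<in> U" using e \<psi>_X by auto
    next
      assume "\<psi> z \<in> U"
      then obtain r where r: "r > 0" "mball (\<psi> z) r \<subseteq> U" using U by (auto simp: openin_mtopology)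
      then obtain k where k: "(1/2) ^ k < r / 3" using small[of "r / 3"] by auto
      have "mball (e (z k)) (2 * (1/2) ^ k) \<subseteq> mball (\<psi> z) r"
        using \<psi>[OF z, of k] k commute[of "e (z k)" "\<psi> z"] \<psi>_X
        by (intro mball_subset) linarith+
      then show "z \<in> (\<Union>k. ?B k)" using r(2) by auto
    qed
    have outQ: "\<psi> z = e 0" if "z \<notin> Q" for z using that by (simp add: \<psi>_def)
    have "\<psi> -` U \<inter> space borel = (Q \<inter> (\<Union>k. ?B k)) \<union> (if e 0 \<in> U then - Q else {})" (is "?L = ?R")
    proof (rule set_eqI)
      show "z \<in> ?L \<longleftrightarrow> z \<in> ?R" for z
        by (cases "z \<in> Q") (use inQ[of z] outQ[of z] in simp_all)
    qed
    also have "\<dots> \<in> sets borel"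
    proof -
      have "(\<Union>k. ?B k) \<in> sets borel" by (intro sets.countable_UN'' borel_coordinate) auto
      then show ?thesis using Q_borel by auto
    qed
    finally show "\<psi> -` U \<inter> space borel \<in> sets borel" .
  qed
  moreover have "\<psi> (\<phi> x) = x" if "x \<in> space M" for x
  proof -
    have x: "x \<in> X" using that X by simp
    have "d (e (\<phi> x k)) (e (\<phi> x l)) \<le> (1/2) ^ k + (1/2) ^ l" for k l
      using triangle[OF e x e, of "\<phi> x k" "\<phi> x l"] \<phi>[OF x, of k] \<phi>[OF x, of l]
        commute[of x "e (\<phi> x l)"] by linarith
    then have Q: "\<phi> x \<in> Q" by (simp add: Q_def)
    have "d (\<psi> (\<phi> x)) x \<le> 0"
    proof (rule field_le_epsilon)
      fix \<epsilon> :: real assume "\<epsilon> > 0"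
      then obtain k where "(1/2) ^ k < \<epsilon> / 2" using small[of "\<epsilon> / 2"] by auto
      then show "d (\<psi> (\<phi> x)) x \<le> 0 + \<epsilon>"
        using triangle[OF \<psi>_X e x, of "\<phi> x" "\<phi> x k"] \<psi>[OF Q, of k] \<phi>[OF x, of k] by linarith
    qed
    then show ?thesis using zero[OF \<psi>_X x] nonneg[of "\<psi> (\<phi> x)" x] by (simp add: antisym)
  qed
  ultimately show ?thesis using \<phi>_meas that by blast
qed

text \<open>Transport to the Baire space along the coding: the section over \<open>\<phi> x\<close>
  is the injective image of the section over \<open>x\<close>, so the counts agree.\<close>

proposition measurable_section_card:
  assumes M: "standard_borel_space M" and F: "F \<in> sets (M \<Otimes>\<^sub>M M)"
    and fin: "\<And>x. x \<in> space M \<Longrightarrow> finite {y. (x, y) \<in> F}"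
    and card: "\<And>x. x \<in> space M \<Longrightarrow> card {y. (x, y) \<in> F} \<le> d"
  shows "{x \<in> space M. k \<le> card {y. (x, y) \<in> F}} \<in> sets M"
proof (cases "space M = {}")
  case False
  obtain \<phi> :: "'a \<Rightarrow> nat \<Rightarrow> nat" and \<psi> where \<phi>: "\<phi> \<in> M \<rightarrow>\<^sub>M borel" and \<psi>: "\<psi> \<in> borel \<rightarrow>\<^sub>M M"
    and inv: "\<And>x. x \<in> space M \<Longrightarrow> \<psi> (\<phi> x) = x"
    using standard_borel_coding[OF M False] by blast
  have F_sub: "F \<subseteq> space M \<times> space M" using sets.sets_into_space[OF F] by (simp add: space_pair_measure)
  \<comment> \<open>This is the image of the space under \<open>\<phi>\<close>, in a form that is
    visibly Borel. Off it the sections of \<open>F'\<close> are empty.\<close>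
  define Z where "Z = {z. \<phi> (\<psi> z) = z}"
  define F' where "F' = {p. fst p \<in> Z \<and> snd p \<in> Z \<and> (\<psi> (fst p), \<psi> (snd p)) \<in> F}"
  have \<psi>_space: "\<psi> z \<in> space M" for z using measurable_space[OF \<psi>, of z] by simp
  have Z: "Z \<in> sets borel"
  proof -
    have "(\<lambda>z. \<phi> (\<psi> z)) \<in> borel \<rightarrow>\<^sub>M borel" using measurable_compose[OF \<psi> \<phi>] .
    then have "{z \<in> space borel. \<phi> (\<psi> z) = z} \<in> sets borel"
      by (rule measurable_equality_set) simp
    then show ?thesis by (simp add: Z_def)
  qed
  have F'_borel: "F' \<in> sets borel"
  proof -
    have [measurable]: "fst \<in> (borel :: ((nat \<Rightarrow> nat) \<times> (nat \<Rightarrow> nat)) measure) \<rightarrow>\<^sub>M borel"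
      "snd \<in> (borel :: ((nat \<Rightarrow> nat) \<times> (nat \<Rightarrow> nat)) measure) \<rightarrow>\<^sub>M borel"
      by (intro borel_measurable_continuous_onI continuous_on_fst continuous_on_snd continuous_on_id)+
    note [measurable] = Z F \<psi>
    have "F' = {p \<in> space borel. fst p \<in> Z \<and> snd p \<in> Z \<and> (\<psi> (fst p), \<psi> (snd p)) \<in> F}"
      by (simp add: F'_def)
    also have "\<dots> \<in> sets borel" by measurable
    finally show ?thesis .
  qed
  have \<phi>Z: "\<phi> x \<in> Z" if "x \<in> space M" for x using inv[OF that] by (simp add: Z_def)
  have sec: "{y. (\<phi> x, y) \<in> F'} = \<phi> ` {y. (x, y) \<in> F}" if x: "x \<in> space M" for x
  proof
    show "{y. (\<phi> x, y) \<in> F'} \<subseteq> \<phi> ` {y. (x, y) \<in> F}"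
    proof clarify
      fix y assume "(\<phi> x, y) \<in> F'"
      then have "\<phi> (\<psi> y) = y" "(x, \<psi> y) \<in> F" using inv[OF x] by (auto simp: F'_def Z_def)
      then show "y \<in> \<phi> ` {y. (x, y) \<in> F}" by (metis image_eqI mem_Collect_eq)
    qed
    show "\<phi> ` {y. (x, y) \<in> F} \<subseteq> {y. (\<phi> x, y) \<in> F'}"
    proof clarify
      fix y assume y: "(x, y) \<in> F"
      then have "y \<in> space M" using F_sub by auto
      then show "(\<phi> x, \<phi> y) \<in> F'" using y x inv \<phi>Z by (simp add: F'_def)
    qed
  qed
  have card_eq: "card {y. (\<phi> x, y) \<in> F'} = card {y. (x, y) \<in> F}" if "x \<in> space M" for x
    unfolding sec[OF that]
  proof (rule card_image, rule inj_onI)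
    fix y z assume "y \<in> {y. (x, y) \<in> F}" "z \<in> {y. (x, y) \<in> F}" "\<phi> y = \<phi> z"
    then have "y \<in> space M" "z \<in> space M" using F_sub by auto
    then show "y = z" using inv \<open>\<phi> y = \<phi> z\<close> by metis
  qed
  have "finite {y. (z, y) \<in> F'} \<and> card {y. (z, y) \<in> F'} \<le> d" for z
  proof (cases "z \<in> Z")
    case True
    then have z: "z = \<phi> (\<psi> z)" by (simp add: Z_def)
    show ?thesis
      using sec[OF \<psi>_space[of z]] card_eq[OF \<psi>_space[of z]] fin[OF \<psi>_space[of z]] card[OF \<psi>_space[of z]]
      unfolding z[symmetric] by simp
  qed (simp add: F'_def)
  then have "{z. k \<le> card {y. (z, y) \<in> F'}} \<in> sets borel"
    using borel_section_card[OF F'_borel] by blast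
  then have "\<phi> -` {z. k \<le> card {y. (z, y) \<in> F'}} \<inter> space M \<in> sets M"
    using \<phi> by (rule measurable_sets[rotated])
  moreover have "\<phi> -` {z. k \<le> card {y. (z, y) \<in> F'}} \<inter> space M = {x \<in> space M. k \<le> card {y. (x, y) \<in> F}}"
    using card_eq by auto
  ultimately show ?thesis by simp
qed simp

subsection \<open>Unhappy vertices flip finitely often\<close>

lemma relpow_graph_dist:
  assumes "(x, y) \<in> G\<^sup>*"
  shows "(x, y) \<in> G ^^ graph_dist G x y"
proof -
  obtain n where "(x, y) \<in> G ^^ n" using rtrancl_imp_relpow[OF assms] by blast
  then show ?thesis unfolding graph_dist_def by (rule LeastI)
qed

lemma graph_dist_le: "(x, y) \<in> G ^^ n \<Longrightarrow> graph_dist G x y \<le> n"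
  unfolding graph_dist_def by (rule Least_le)

lemma graph_dist_self [simp]: "graph_dist G x x = 0"
  using graph_dist_le[of x x 0 G] by simp

lemma graph_dist_step:
  assumes "(x, y) \<in> G\<^sup>*" "(y, z) \<in> G"
  shows "graph_dist G x z \<le> Suc (graph_dist G x y)"
  using relpow_Suc_I[OF relpow_graph_dist[OF assms(1)] assms(2)] by (rule graph_dist_le)

text \<open>Eventually the ball of radius \<open>r\<close> has fewer than \<open>1 / q ^ r\<close>
  points. One half of the exponent \<open>2 * r\<close> absorbs this, the other half leaves a
  geometric series. This works for every \<open>q\<close> in the unit interval, which leaves
  \<open>q\<close> free for the degree condition.\<close>

lemma summable_on_component:
  fixes q :: real
  assumes fin: "\<And>r. finite (graph_ball G x r)"
    and growth: "(\<lambda>r. 1 / real r * ln (real (card (graph_ball G x r)))) \<longlonglongrightarrow> 0"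
    and q: "0 < q" "q < 1"
  shows "(\<lambda>y. q ^ (2 * graph_dist G x y)) summable_on {y. (x, y) \<in> G\<^sup>*}"
proof -
  define b where "b r = real (card (graph_ball G x r))" for r
  have b1: "b r \<ge> 1" for r
  proof -
    have "x \<in> graph_ball G x r" by (simp add: graph_ball_def)
    then have "card (graph_ball G x r) \<noteq> 0" using fin by auto
    then show ?thesis by (simp add: b_def)
  qed
  have "0 < - ln q" using q by simp
  with growth have "\<forall>\<^sub>F r in sequentially. 1 / real r * ln (b r) < - ln q"
    unfolding b_def by (rule order_tendstoD(2))
  then have "\<forall>\<^sub>F r in sequentially. norm (q ^ (2 * r) * b r) \<le> q ^ r"
    using eventually_gt_at_top[of 0]
  proof eventually_elim
    case (elim r)
    then have "ln (b r) < - (r * ln q)" by (simp add: field_simps)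
    also have "- (r * ln q) = ln (1 / q ^ r)" using q by (simp add: ln_div ln_realpow)
    finally have "b r < 1 / q ^ r" using b1[of r] q by simp
    then have "b r * q ^ r < 1" using q by (simp add: field_simps)
    then have "b r * q ^ r * q ^ r \<le> 1 * q ^ r" using q by (intro mult_right_mono) auto
    moreover have "q ^ (2 * r) * b r = b r * q ^ r * q ^ r" unfolding mult_2 power_add by simp
    moreover have "0 \<le> q ^ (2 * r) * b r" using q b1[of r] by simp
    ultimately show ?case by (metis abs_of_nonneg mult_1 real_norm_def)
  qed
  then have sum: "summable (\<lambda>r. q ^ (2 * r) * b r)"
    using q by (intro summable_comparison_test_ev[OF _ summable_geometric]) auto
  show ?thesis
  proof (rule nonneg_bdd_above_summable_on)
    show "0 \<le> q ^ (2 * graph_dist G x y)" for y using q by simp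
    show "bdd_above (sum (\<lambda>y. q ^ (2 * graph_dist G x y)) ` {F. F \<subseteq> {y. (x, y) \<in> G\<^sup>*} \<and> finite F})"
    proof (rule bdd_aboveI2)
      fix F assume "F \<in> {F. F \<subseteq> {y. (x, y) \<in> G\<^sup>*} \<and> finite F}"
      then have F: "F \<subseteq> {y. (x, y) \<in> G\<^sup>*}" "finite F" by auto
      have "(\<Sum>y\<in>F. q ^ (2 * graph_dist G x y))
          = (\<Sum>r\<in>graph_dist G x ` F. \<Sum>y\<in>{y \<in> F. graph_dist G x y = r}. q ^ (2 * graph_dist G x y))"
        by (rule sum.image_gen[OF F(2)])
      also have "\<dots> = (\<Sum>r\<in>graph_dist G x ` F. q ^ (2 * r) * real (card {y \<in> F. graph_dist G x y = r}))"
        by (intro sum.cong) (simp_all add: mult.commute)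
      also have "\<dots> \<le> (\<Sum>r\<in>graph_dist G x ` F. q ^ (2 * r) * b r)"
      proof (intro sum_mono mult_left_mono)
        fix r
        have "{y \<in> F. graph_dist G x y = r} \<subseteq> graph_ball G x r"
          using F by (auto simp: graph_ball_def)
        then show "real (card {y \<in> F. graph_dist G x y = r}) \<le> b r"
          using card_mono[OF fin] by (simp add: b_def)
      qed (use q in simp)
      also have "\<dots> \<le> (\<Sum>r. q ^ (2 * r) * b r)"
        using F q by (intro sum_le_suminf sum) (auto simp: b_def)
      finally show "(\<Sum>y\<in>F. q ^ (2 * graph_dist G x y)) \<le> (\<Sum>r. q ^ (2 * r) * b r)" .
    qed
  qed
qed

section \<open>The weighted gain of flips\<close>

text \<open>\<open>B\<close> is one color class. Strictness leaves ties alone and makes the integer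
  surplus at least 1.\<close>

definition unhappy :: "'a rel \<Rightarrow> 'a set \<Rightarrow> 'a \<Rightarrow> bool" where
  "unhappy G B y \<longleftrightarrow>
     card {z \<in> nbrs G y. (z \<in> B) \<noteq> (y \<in> B)} < card {z \<in> nbrs G y. (z \<in> B) = (y \<in> B)}"

text \<open>With \<open>u\<close> neighbors of the other color and at least \<open>u + 1\<close> of
  the same color, the sum is at least \<open>q * (u + 1) - u / q\<close> times \<open>w y\<close>.
  This factor is \<open>q - u * (1 / q - q)\<close>, and \<open>u \<le> d\<close>.\<close>

lemma unhappy_weight_gain:
  fixes w :: "'a \<Rightarrow> real"
  assumes fin: "finite (nbrs G y)" and deg: "card (nbrs G y) \<le> d" and "unhappy G B y"
    and q: "0 < q" "q < 1" and "w y > 0"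
    and w: "\<And>z. z \<in> nbrs G y \<Longrightarrow> q * w y \<le> w z" "\<And>z. z \<in> nbrs G y \<Longrightarrow> q * w z \<le> w y"
  shows "(q - d * (1 / q - q)) * w y \<le> (\<Sum>z\<in>nbrs G y. if (z \<in> B) = (y \<in> B) then w z else - w z)"
proof -
  let ?F = "{z \<in> nbrs G y. (z \<in> B) = (y \<in> B)}" and ?U = "{z \<in> nbrs G y. (z \<in> B) \<noteq> (y \<in> B)}"
  have "card ?U + 1 \<le> card ?F" using assms(3) by (simp add: unhappy_def)
  then have FU: "real (card ?U) + 1 \<le> card ?F" by linarith
  have U: "real (card ?U) \<le> d" using card_mono[OF fin, of ?U] deg by auto
  have "1 / q - q \<ge> 0"
    using q mult_strict_mono[of q 1 q 1] by (simp add: field_simps)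
  then have "card ?U * (1 / q - q) \<le> d * (1 / q - q)" using U by (rule mult_right_mono[rotated])
  moreover have "(card ?U + 1) * q \<le> card ?F * q" using FU q by (intro mult_right_mono) auto
  ultimately have "q - d * (1 / q - q) \<le> card ?F * q - card ?U * (1 / q)"
    by (simp add: algebra_simps)
  then have "(q - d * (1 / q - q)) * w y \<le> (card ?F * q - card ?U * (1 / q)) * w y"
    using \<open>w y > 0\<close> by (intro mult_right_mono) auto
  also have "\<dots> = (\<Sum>z\<in>?F. q * w y) - (\<Sum>z\<in>?U. w y / q)"
    by (simp add: algebra_simps)
  also have "\<dots> \<le> (\<Sum>z\<in>?F. w z) - (\<Sum>z\<in>?U. w z)"
    using w q by (intro diff_mono sum_mono) (auto simp: field_simps)
  also have "\<dots> = (\<Sum>z\<in>nbrs G y. if (z \<in> B) = (y \<in> B) then w z else - w z)"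
  proof -
    have "nbrs G y = ?F \<union> ?U" "?F \<inter> ?U = {}" by auto
    then have "(\<Sum>z\<in>nbrs G y. if (z \<in> B) = (y \<in> B) then w z else - w z)
      = (\<Sum>z\<in>?F. if (z \<in> B) = (y \<in> B) then w z else - w z)
        + (\<Sum>z\<in>?U. if (z \<in> B) = (y \<in> B) then w z else - w z)"
      using fin by (metis (no_types, lifting) finite_Un sum.union_disjoint)
    also have "\<dots> = (\<Sum>z\<in>?F. w z) + (\<Sum>z\<in>?U. - w z)"
      by (intro arg_cong2[where f = "(+)"] sum.cong) auto
    finally show ?thesis by (simp add: sum_negf)
  qed
  finally show ?thesis .
qed

text \<open>Potential argument: \<open>L n\<close> is the total weight of the monochromatic edges of \<open>B n\<close> (as ordered
  pairs), and only the edges with exactly one end in the flipped set \<open>S\<close> change their status.\<close>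

proposition finitely_many_flips:
  fixes B :: "nat \<Rightarrow> 'a set" and q :: real
  assumes G: "sym G" and fin: "\<And>y. finite (nbrs G y)" and deg: "\<And>y. card (nbrs G y) \<le> d"
    and q: "0 < q" "q < 1" "d * (1 / q - q) < q"
    and summ: "(\<lambda>y. q ^ (2 * graph_dist G x y)) summable_on {y. (x, y) \<in> G\<^sup>*}"
    and flip: "\<And>n y. (y \<in> B (Suc n)) \<noteq> (y \<in> B n) \<Longrightarrow> unhappy G (B n) y"
    and indep: "\<And>n y z. (y \<in> B (Suc n)) \<noteq> (y \<in> B n) \<Longrightarrow> (y, z) \<in> G \<Longrightarrow> (z \<in> B (Suc n)) = (z \<in> B n)"
  shows "finite {n. (x \<in> B (Suc n)) \<noteq> (x \<in> B n)}"
proof -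
  define C where "C = {y. (x, y) \<in> G\<^sup>*}"
  define w where "w y = q ^ graph_dist G x y" for y
  define P where "P = Sigma C (nbrs G)"
  define W where "W p = w (fst p) * w (snd p)" for p
  define a :: "nat \<Rightarrow> 'a \<times> 'a \<Rightarrow> real"
    where "a n p = (if (fst p \<in> B n) = (snd p \<in> B n) then 1 else 0)" for n p
  define L where "L n = infsum (\<lambda>p. W p * a n p) P" for n
  define \<epsilon> where "\<epsilon> = q - d * (1 / q - q)"
  have \<epsilon>: "\<epsilon> > 0" using q(3) by (simp add: \<epsilon>_def)
  have w_pos: "w y > 0" for y using q by (simp add: w_def)
  have xC: "x \<in> C" and wx: "w x = 1" by (simp_all add: C_def w_def)
  have edge_sym: "(z, y) \<in> G" if "(y, z) \<in> G" for y z using G that by (rule symD)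
  have C_step: "z \<in> C" if "y \<in> C" "z \<in> nbrs G y" for y z
    using that by (auto simp: C_def nbrs_def intro: rtrancl_into_rtrancl)
  have w_step: "q * w y \<le> w z" if "y \<in> C" "z \<in> nbrs G y" for y z
  proof -
    have "graph_dist G x z \<le> Suc (graph_dist G x y)"
      using that by (intro graph_dist_step) (auto simp: C_def nbrs_def)
    then have "q ^ Suc (graph_dist G x y) \<le> q ^ graph_dist G x z"
      using q by (intro power_decreasing) auto
    then show ?thesis by (simp add: w_def)
  qed
  have w_step': "q * w z \<le> w y" if "y \<in> C" "z \<in> nbrs G y" for y z
  proof (rule w_step)
    show "z \<in> C" using C_step that by blast
    show "y \<in> nbrs G z" using that(2) edge_sym by (simp add: nbrs_def)
  qed
  have W_nonneg: "W p \<ge> 0" for p using w_pos by (simp add: W_def less_imp_le)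
  have W_summable: "W summable_on P"
    unfolding P_def
  proof (rule summable_on_SigmaI)
    show "((\<lambda>z. W (y, z)) has_sum (\<Sum>z\<in>nbrs G y. W (y, z))) (nbrs G y)" for y
      using fin by (rule has_sum_finite)
    \<comment> \<open>A vertex has at most \<open>d\<close> neighbors \<open>z\<close>, each with
      \<open>w z \<le> w y / q\<close>; this is the origin of \<open>d / q\<close>.\<close>
    have "(\<lambda>y. (d / q) * (w y)\<^sup>2) summable_on C"
      using summ by (intro summable_on_cmult_right) (simp add: C_def w_def power_mult mult.commute flip: power_mult)
    then show "(\<lambda>y. \<Sum>z\<in>nbrs G y. W (y, z)) summable_on C"
    proof (rule summable_on_comparison_test)
      fix y assume y: "y \<in> C"
      have "(\<Sum>z\<in>nbrs G y. W (y, z)) \<le> (\<Sum>z\<in>nbrs G y. (w y)\<^sup>2 / q)"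
      proof (rule sum_mono)
        fix z assume "z \<in> nbrs G y"
        then have "w z \<le> w y / q" using w_step'[OF y] q by (simp add: field_simps)
        then have "w y * w z \<le> w y * (w y / q)" using w_pos[of y] by (intro mult_left_mono) auto
        then show "W (y, z) \<le> (w y)\<^sup>2 / q" by (simp add: W_def power2_eq_square)
      qed
      also have "\<dots> = card (nbrs G y) * ((w y)\<^sup>2 / q)" by simp
      also have "\<dots> \<le> d * ((w y)\<^sup>2 / q)" using deg q by (intro mult_right_mono) auto
      finally show "(\<Sum>z\<in>nbrs G y. W (y, z)) \<le> (d / q) * (w y)\<^sup>2" by simp
      show "0 \<le> (\<Sum>z\<in>nbrs G y. W (y, z))" using W_nonneg by (intro sum_nonneg)
    qed
    show "0 \<le> W (y, z)" for y z by (rule W_nonneg)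
  qed
  have bounded_summable: "(\<lambda>p. W p * h p) summable_on A" if "A \<subseteq> P" "\<And>p. \<bar>h p\<bar> \<le> 1" for h A
  proof -
    have "(\<lambda>p. norm (W p * h p)) summable_on P"
    proof (rule Infinite_Sum.abs_summable_on_comparison_test)
      show "(\<lambda>p. norm (W p)) summable_on P"
        using W_summable by (rule summable_on_iff_abs_summable_on_real[THEN iffD1])
      show "norm (W p * h p) \<le> norm (W p)" for p
        using that(2)[of p] W_nonneg[of p] by (simp add: abs_mult mult_left_le)
    qed
    then have "(\<lambda>p. W p * h p) summable_on P"
      by (rule summable_on_iff_abs_summable_on_real[THEN iffD2])
    then show ?thesis using that(1) by (rule summable_on_subset)
  qed
  have L_nonneg: "L n \<ge> 0" for n
    unfolding L_def using W_nonneg by (intro infsum_nonneg) (simp add: a_def)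
  have decrease: "L (Suc n) + (if (x \<in> B (Suc n)) \<noteq> (x \<in> B n) then 2 * \<epsilon> else 0) \<le> L n" for n
  proof -
    define S where "S = {y. (y \<in> B (Suc n)) \<noteq> (y \<in> B n)}"
    define h where "h p = a n p - a (Suc n) p" for p
    have h1: "\<bar>h p\<bar> \<le> 1" for p by (simp add: h_def a_def)
    let ?f = "\<lambda>p. W p * h p"
    \<comment> \<open>The pairs whose first end flips; \<open>P2\<close> holds their reversals. By
      independence the two are disjoint, and all other pairs keep their status. The symmetry is the
      source of the factor 2 below.\<close>
    define P1 where "P1 = Sigma (C \<inter> S) (nbrs G)"
    define P2 where "P2 = prod.swap ` P1"
    have P1: "P1 \<subseteq> P" by (auto simp: P1_def P_def)
    have P2_iff: "(y, z) \<in> P2 \<longleftrightarrow> (y, z) \<in> P \<and> z \<in> S" for y z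
    proof
      assume "(y, z) \<in> P2"
      then have "z \<in> C" "z \<in> S" "(z, y) \<in> G" by (auto simp: P2_def P1_def nbrs_def)
      then show "(y, z) \<in> P \<and> z \<in> S"
        using C_step edge_sym by (auto simp: P_def nbrs_def)
    next
      assume "(y, z) \<in> P \<and> z \<in> S"
      then have "(z, y) \<in> P1" using C_step edge_sym by (auto simp: P_def P1_def nbrs_def)
      then show "(y, z) \<in> P2" by (force simp: P2_def)
    qed
    then have P2: "P2 \<subseteq> P" by auto
    have S_indep: "z \<notin> S" if "y \<in> S" "(y, z) \<in> G" for y z
      using indep[of y n z] that by (simp add: S_def)
    have disj: "P1 \<inter> P2 = {}"
      using S_indep by (auto simp: P2_iff P1_def nbrs_def)
    have f_summable: "?f summable_on A" if "A \<subseteq> P" for A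
      using that h1 by (rule bounded_summable)
    have a_summable: "(\<lambda>p. W p * a n p) summable_on P" for n
      by (rule bounded_summable) (auto simp: a_def)
    have "L n - L (Suc n) = infsum (\<lambda>p. W p * a n p + - (W p * a (Suc n) p)) P"
      unfolding L_def
      by (subst infsum_add) (simp_all add: infsum_uminus summable_on_uminus a_summable)
    also have "\<dots> = infsum ?f P" by (simp add: h_def algebra_simps)
    also have "\<dots> = infsum ?f (P1 \<union> P2)"
    proof (rule infsum_cong_neutral)
      show "?f p = 0" if "p \<in> P - (P1 \<union> P2)" for p
      proof -
        obtain y z where p: "p = (y, z)" by (cases p)
        with that have "y \<notin> S" "z \<notin> S" by (auto simp: P2_iff P1_def P_def)
        then show ?thesis by (auto simp: h_def a_def S_def p)
      qed
    qed (use P1 P2 in auto)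
    also have "\<dots> = infsum ?f P1 + infsum ?f P2"
      using disj by (intro infsum_Un_disjoint f_summable P1 P2)
    also have "infsum ?f P2 = infsum (?f \<circ> prod.swap) P1"
      unfolding P2_def by (rule infsum_reindex) simp
    also have "?f \<circ> prod.swap = ?f"
      by (auto simp: W_def h_def a_def fun_eq_iff)
    also have "infsum ?f P1 = infsum (\<lambda>y. infsum (\<lambda>z. ?f (y, z)) (nbrs G y)) (C \<inter> S)"
      unfolding P1_def
      by (rule infsum_Sigma_banach[symmetric]) (use f_summable P1 in \<open>simp add: P1_def\<close>)
    finally have diff: "L n - L (Suc n) = 2 * infsum (\<lambda>y. \<Sum>z\<in>nbrs G y. ?f (y, z)) (C \<inter> S)"
      using fin by simp
    \<comment> \<open>No neighbor of \<open>y\<close> flips, so every edge at \<open>y\<close>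
      changes status and the sign in \<open>unhappy_weight_gain\<close> is \<open>h\<close>.
      Multiplying by \<open>w y\<close> turns vertex weights into edge weights.\<close>
    have gain: "\<epsilon> * (w y)\<^sup>2 \<le> (\<Sum>z\<in>nbrs G y. ?f (y, z))" if y: "y \<in> C" "y \<in> S" for y
    proof -
      have "(\<epsilon> * w y) * w y \<le> (\<Sum>z\<in>nbrs G y. if (z \<in> B n) = (y \<in> B n) then w z else - w z) * w y"
        unfolding \<epsilon>_def
        using y flip w_pos[of y] q w_step w_step' fin deg
        by (intro mult_right_mono unhappy_weight_gain) (auto simp: S_def)
      also have "\<dots> = (\<Sum>z\<in>nbrs G y. ?f (y, z))"
        unfolding sum_distrib_right
      proof (rule sum.cong)
        fix z assume "z \<in> nbrs G y"
        then have "(z \<in> B (Suc n)) = (z \<in> B n)" "(y \<in> B (Suc n)) \<noteq> (y \<in> B n)"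
          using y(2) indep by (auto simp: S_def nbrs_def)
        then show "(if (z \<in> B n) = (y \<in> B n) then w z else - w z) * w y = ?f (y, z)"
          by (auto simp: W_def h_def a_def)
      qed simp
      finally show ?thesis by (simp add: power2_eq_square mult.assoc)
    qed
    have nonneg: "0 \<le> (\<Sum>z\<in>nbrs G y. ?f (y, z))" if y: "y \<in> C" "y \<in> S" for y
      using gain[OF that] \<epsilon> by (meson less_imp_le mult_nonneg_nonneg order_trans zero_le_power2)
    show ?thesis
    proof (cases "x \<in> S")
      case False
      have "0 \<le> infsum (\<lambda>y. \<Sum>z\<in>nbrs G y. ?f (y, z)) (C \<inter> S)"
        using nonneg by (intro infsum_nonneg) auto
      then show ?thesis using diff False by (simp add: S_def)
    next
      \<comment> \<open>The term at \<open>x\<close> alone contributes \<open>\<epsilon>\<close>,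
        since \<open>w x = 1\<close>; the other terms are nonnegative.\<close>
      case True
      have "(\<lambda>y. infsum (\<lambda>z. ?f (y, z)) (nbrs G y)) summable_on (C \<inter> S)"
        by (rule summable_on_Sigma_banach) (use f_summable P1 in \<open>simp add: P1_def case_prod_unfold\<close>)
      then have "sum (\<lambda>y. \<Sum>z\<in>nbrs G y. ?f (y, z)) {x} \<le> infsum (\<lambda>y. \<Sum>z\<in>nbrs G y. ?f (y, z)) (C \<inter> S)"
        using True xC nonneg fin by (intro finite_sum_le_infsum) auto
      then show ?thesis using diff gain[OF xC True] True by (simp add: wx S_def)
    qed
  qed
  let ?N = "{n. (x \<in> B (Suc n)) \<noteq> (x \<in> B n)}"
  \<comment> \<open>Telescoping: every flip of \<open>x\<close> consumes
    \<open>2 * \<epsilon>\<close> of the initial weight.\<close>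
  have bound: "2 * \<epsilon> * card (?N \<inter> {..<m}) + L m \<le> L 0" for m
  proof (induction m)
    case (Suc m)
    have "?N \<inter> {..<Suc m} = (if m \<in> ?N then insert m (?N \<inter> {..<m}) else ?N \<inter> {..<m})"
      by (auto simp: less_Suc_eq)
    then show ?case using Suc decrease[of m] by (auto simp: algebra_simps split: if_splits)
  qed simp
  obtain K :: nat where K: "L 0 / (2 * \<epsilon>) < K" using reals_Archimedean2 by blast
  show ?thesis
  proof (rule ccontr)
    assume "infinite ?N"
    then obtain A where A: "A \<subseteq> ?N" "finite A" "card A = K" using infinite_arbitrarily_large by blast
    then obtain m where "A \<subseteq> {..<m}" using finite_nat_iff_bounded by blast
    then have "K \<le> card (?N \<inter> {..<m})" using A by (metis (no_types, lifting) card_mono finite_Int finite_lessThan le_inf_iff)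
    then have "2 * \<epsilon> * K \<le> 2 * \<epsilon> * card (?N \<inter> {..<m})" using \<epsilon> by (intro mult_left_mono) auto
    then have "2 * \<epsilon> * K \<le> L 0" using bound[of m] L_nonneg[of m] by linarith
    then show False using K \<epsilon> by (simp add: field_simps)
  qed
qed

subsection \<open>Borel unfriendly colorings\<close>

lemma measurable_nat_upper_sets:
  fixes f :: "'a \<Rightarrow> nat"
  assumes "\<And>k. {x \<in> space M. k \<le> f x} \<in> sets M"
  shows "f \<in> borel_measurable M"
proof -
  have "f -` {k} \<inter> space M \<in> sets M" for k
  proof -
    have "f -` {k} \<inter> space M = {x \<in> space M. k \<le> f x} - {x \<in> space M. Suc k \<le> f x}" by auto
    also have "\<dots> \<in> sets M" using assms by (intro sets.Diff)
    finally show ?thesis .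
  qed
  then have "f \<in> M \<rightarrow>\<^sub>M count_space UNIV" by (simp add: measurable_count_space_eq2_countable)
  then show ?thesis by (simp add: measurable_cong_sets[OF refl sets_borel_eq_count_space])
qed

lemma edge_weight_exists:
  fixes d :: nat
  obtains q :: real where "0 < q" "q < 1" "d * (1 / q - q) < q"
proof -
  define D where "D = real d"
  have D: "D \<ge> 0" by (simp add: D_def)
  \<comment> \<open>The requirement amounts to \<open>q\<^sup>2 > D / (D + 1)\<close>, and
    \<open>(2 * D + 1)\<^sup>2\<close> exceeds \<open>4 * D * (D + 1)\<close> by exactly 1.\<close>
  define q where "q = (2 * D + 1) / (2 * D + 2)"
  have q: "0 < q" "q < 1" using D by (simp_all add: q_def)
  have eq: "q * (2 * D + 2) = 2 * D + 1" using D by (simp add: q_def)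
  have "((D + 1) * (q * q)) * (4 * (D + 1)) = (q * (2 * D + 2)) * (q * (2 * D + 2))"
    by (simp add: algebra_simps)
  also have "\<dots> = D * (4 * (D + 1)) + 1" unfolding eq by (simp add: algebra_simps)
  finally have "D * (4 * (D + 1)) < ((D + 1) * (q * q)) * (4 * (D + 1))" by linarith
  then have "D < (D + 1) * (q * q)" by (rule mult_right_less_imp_less) (use D in simp)
  then have "D * (1 - q * q) < q * q" by (simp add: algebra_simps)
  then have "D * (1 / q - q) < q" using q by (simp add: field_simps)
  then show ?thesis using that q by (simp add: D_def)
qed

theorem theorem3:
  fixes M :: "'a measure" and G :: "'a rel"
  assumes "standard_borel_space M"
    and "borel_graph M G"
    and "bounded_degree M G"
    and "subexponential_growth M G"
  shows "\<exists>c :: 'a \<Rightarrow> nat.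
           c \<in> M \<rightarrow>\<^sub>M count_space {0, 1} \<and> unfriendly_coloring M G c"
proof (cases "space M = {}")
  case True
  then show ?thesis by (intro exI[of _ "\<lambda>_. 0"]) (simp add: unfriendly_coloring_def)
next
  case False
  have G: "G \<in> sets (M \<Otimes>\<^sub>M M)" "sym G" "irrefl G"
    using assms(2) by (auto simp: borel_graph_def)
  have G_sub: "G \<subseteq> space M \<times> space M"
    using sets.sets_into_space[OF G(1)] by (simp add: space_pair_measure)
  then have nbrs_sub: "nbrs G x \<subseteq> space M" for x by (auto simp: nbrs_def)
  obtain d where d: "\<And>x. x \<in> space M \<Longrightarrow> finite (nbrs G x) \<and> card (nbrs G x) \<le> d"
    using assms(3) by (auto simp: bounded_degree_def)
  have nbrs_out: "nbrs G x = {}" if "x \<notin> space M" for x using that G_sub by (auto simp: nbrs_def)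
  have fin: "finite (nbrs G x)" and deg: "card (nbrs G x) \<le> d" for x
    using d nbrs_out by (cases "x \<in> space M"; simp)+
  have card_meas: "(\<lambda>x. card (nbrs G x \<inter> B)) \<in> borel_measurable M" if B: "B \<in> sets M" for B
  proof (rule measurable_nat_upper_sets)
    fix k
    define F where "F = G \<inter> space M \<times> B"
    have sec: "{y. (x, y) \<in> F} = nbrs G x \<inter> B" for x
      using G_sub by (auto simp: F_def nbrs_def)
    have "F \<in> sets (M \<Otimes>\<^sub>M M)" using G(1) B by (auto simp: F_def)
    then have "{x \<in> space M. k \<le> card {y. (x, y) \<in> F}} \<in> sets M"
    proof (rule measurable_section_card[OF assms(1)])
      show "card {y. (x, y) \<in> F} \<le> d" for x
        unfolding sec using card_mono[OF fin, of "nbrs G x \<inter> B" x] deg[of x] by simp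
    qed (simp add: sec fin)
    then show "{x \<in> space M. k \<le> card (nbrs G x \<inter> B)} \<in> sets M" by (simp add: sec)
  qed
  have unhappy_meas: "{x \<in> space M. unhappy G B x} \<in> sets M" if B: "B \<in> sets M" for B
  proof -
    note [measurable] = B card_meas[OF B] card_meas[OF sets.compl_sets[OF B]]
    have "{z \<in> nbrs G x. z \<in> B} = nbrs G x \<inter> B" "{z \<in> nbrs G x. z \<notin> B} = nbrs G x \<inter> (space M - B)" for x
      using nbrs_sub by auto
    then have eq: "unhappy G B x \<longleftrightarrow>
        x \<in> B \<and> card (nbrs G x \<inter> (space M - B)) < card (nbrs G x \<inter> B) \<or>
        x \<notin> B \<and> card (nbrs G x \<inter> B) < card (nbrs G x \<inter> (space M - B))" for x
      by (cases "x \<in> B") (simp_all add: unhappy_def)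
    show ?thesis unfolding eq by measurable
  qed
  obtain \<phi> :: "'a \<Rightarrow> nat \<Rightarrow> nat" and \<psi> where \<phi>: "\<phi> \<in> M \<rightarrow>\<^sub>M borel"
    and "\<psi> \<in> borel \<rightarrow>\<^sub>M M" and inv: "\<And>x. x \<in> space M \<Longrightarrow> \<psi> (\<phi> x) = x"
    using standard_borel_coding[OF assms(1) False] by blast
  define U where "U s = \<phi> -` cylinder s \<inter> space M" for s
  \<comment> \<open>Dropping from \<open>U s\<close> the vertices with a neighbor in
    \<open>U s\<close> leaves an independent set.\<close>
  define A where "A s = U s - {x \<in> space M. 1 \<le> card (nbrs G x \<inter> U s)}" for s
  have U_sets: "U s \<in> sets M" for s
    unfolding U_def using \<phi> borel_cylinder by (rule measurable_sets)
  have A_sets: "A s \<in> sets M" for s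
  proof -
    note [measurable] = U_sets card_meas[OF U_sets[of s]]
    show ?thesis unfolding A_def by measurable
  qed
  have A_nbr: "y \<notin> A s" if "x \<in> A s" "(x, y) \<in> G" for x y s
  proof
    assume "y \<in> A s"
    then have "y \<in> nbrs G x \<inter> U s" using that by (auto simp: A_def nbrs_def)
    then have "card (nbrs G x \<inter> U s) \<noteq> 0" using fin by auto
    then show False using that by (auto simp: A_def U_def)
  qed
  \<comment> \<open>Take a prefix of \<open>\<phi> x\<close> long enough to differ from those of all
    neighbors; irreflexivity excludes \<open>x\<close> itself as a neighbor.\<close>
  have A_cover: "\<exists>s. x \<in> A s" if x: "x \<in> space M" for x
  proof -
    obtain n where n: "inj_on (\<lambda>w. map w [0..<n]) (\<phi> ` insert x (nbrs G x))"
      using finite_separating_prefix[of "\<phi> ` insert x (nbrs G x)"] fin by auto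
    define s where "s = map (\<phi> x) [0..<n]"
    have "nbrs G x \<inter> U s = {}"
    proof safe
      fix y assume y: "y \<in> nbrs G x" "y \<in> U s"
      then have eq: "map (\<phi> y) [0..<n] = map (\<phi> x) [0..<n]"
        by (simp add: U_def s_def in_cylinder_map_upt)
      have "\<phi> y = \<phi> x" by (rule inj_onD[OF n]) (use y eq in simp_all)
      then have "y = x" using inv x y nbrs_sub by (metis subsetD)
      then show "y \<in> {}" using y G(3) by (auto simp: nbrs_def irrefl_def)
    qed
    then have "x \<in> A s" using x by (simp add: A_def U_def s_def in_cylinder_map_upt)
    then show ?thesis by blast
  qed
  \<comment> \<open>The first component of the pair coded by \<open>n\<close> names the list; the
    second runs freely, so every \<open>A s\<close> recurs at arbitrarily late stages.\<close>
  define E where "E n B = A (from_nat (fst (prod_decode n))) \<inter> {x \<in> space M. unhappy G B x}" for n B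
  define B where "B = rec_nat {} (\<lambda>n B. (B - E n B) \<union> (E n B - B))"
  have B_simps: "B 0 = {}" "B (Suc n) = (B n - E n (B n)) \<union> (E n (B n) - B n)" for n
    by (simp_all add: B_def)
  have flip_iff: "(y \<in> B (Suc n)) \<noteq> (y \<in> B n) \<longleftrightarrow> y \<in> E n (B n)" for y n
    by (auto simp: B_simps)
  have B_sets: "B n \<in> sets M" for n
  proof (induction n)
    case (Suc n)
    then have "E n (B n) \<in> sets M" unfolding E_def using A_sets unhappy_meas by auto
    then show ?case using Suc by (auto simp: B_simps)
  qed (simp add: B_simps)
  obtain q :: real where q: "0 < q" "q < 1" "d * (1 / q - q) < q"
    using edge_weight_exists by blast
  have flips: "finite {n. (x \<in> B (Suc n)) \<noteq> (x \<in> B n)}" if x: "x \<in> space M" for x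
  proof (rule finitely_many_flips[OF G(2) fin deg q])
    show "(\<lambda>y. q ^ (2 * graph_dist G x y)) summable_on {y. (x, y) \<in> G\<^sup>*}"
      using assms(4) x q by (intro summable_on_component) (auto simp: subexponential_growth_def)
  next
    fix n y assume "(y \<in> B (Suc n)) \<noteq> (y \<in> B n)"
    then have y: "y \<in> E n (B n)" by (simp only: flip_iff)
    then show "unhappy G (B n) y" by (simp add: E_def)
    fix z assume "(y, z) \<in> G"
    then have "z \<notin> E n (B n)" using y A_nbr by (auto simp: E_def)
    then show "(z \<in> B (Suc n)) = (z \<in> B n)" using flip_iff by blast
  qed
  \<comment> \<open>Finitely many flips make this lower limit a genuine limit; as a lower limit it
    is Borel at once.\<close>
  define B' where "B' = {x \<in> space M. \<exists>N. \<forall>n\<ge>N. x \<in> B n}"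
  have stable: "\<exists>N. \<forall>n\<ge>N. (x \<in> B n) = (x \<in> B')" if x: "x \<in> space M" for x
  proof -
    obtain N where N: "\<forall>n\<in>{n. (x \<in> B (Suc n)) \<noteq> (x \<in> B n)}. n < N"
      using flips[OF x] finite_nat_set_iff_bounded by blast
    have const: "(x \<in> B n) = (x \<in> B N)" if "n \<ge> N" for n
      using that
    proof (induction n rule: dec_induct)
      case (step n)
      then have "(x \<in> B (Suc n)) = (x \<in> B n)" using N by (force simp: not_less)
      then show ?case using step by simp
    qed simp
    have limit: "x \<in> B' \<longleftrightarrow> x \<in> B N"
    proof
      assume "x \<in> B'"
      then obtain N' where "\<And>n. n \<ge> N' \<Longrightarrow> x \<in> B n" by (auto simp: B'_def)
      then show "x \<in> B N" using const[of "max N N'"] by simp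
    next
      assume "x \<in> B N"
      then have "\<forall>n\<ge>N. x \<in> B n" using const by blast
      then show "x \<in> B'" using x by (auto simp: B'_def)
    qed
    have "(x \<in> B n) = (x \<in> B')" if "n \<ge> N" for n
      unfolding limit by (rule const[OF that])
    then show ?thesis by blast
  qed
  have B'_sets: "B' \<in> sets M"
  proof -
    note [measurable] = B_sets
    show ?thesis unfolding B'_def by measurable
  qed
  define c :: "'a \<Rightarrow> nat" where "c x = (if x \<in> B' then 1 else 0)" for x
  have "c \<in> M \<rightarrow>\<^sub>M count_space {0, 1}"
    unfolding c_def[abs_def] using B'_sets by (intro measurable_If_set) auto
  moreover have "unfriendly_coloring M G c"
    unfolding unfriendly_coloring_def
  proof
    fix x assume x: "x \<in> space M"
    have "\<exists>N. \<forall>n\<ge>N. \<forall>y\<in>insert x (nbrs G x). (y \<in> B n) = (y \<in> B')"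
    proof -
      have "\<forall>y\<in>insert x (nbrs G x). \<forall>\<^sub>F n in sequentially. (y \<in> B n) = (y \<in> B')"
        using stable x nbrs_sub by (auto simp: eventually_sequentially)
      then have "\<forall>\<^sub>F n in sequentially. \<forall>y\<in>insert x (nbrs G x). (y \<in> B n) = (y \<in> B')"
        using fin by (intro eventually_ball_finite) auto
      then show ?thesis by (simp only: eventually_sequentially)
    qed
    then obtain N where N: "\<And>n y. n \<ge> N \<Longrightarrow> y \<in> insert x (nbrs G x) \<Longrightarrow> (y \<in> B n) = (y \<in> B')"
      by blast
    obtain s where s: "x \<in> A s" using A_cover[OF x] by blast
    \<comment> \<open>A stage that treats \<open>A s\<close> after the colors of \<open>x\<close>
      and its neighbors have settled: were \<open>x\<close> unhappy then, it would flip, contrary to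
      stability.\<close>
    define n where "n = prod_encode (to_nat s, N)"
    have n: "n \<ge> N" unfolding n_def by (rule le_prod_encode_2)
    have "(x \<in> B (Suc n)) = (x \<in> B n)" using N[of n x] N[of "Suc n" x] n by simp
    then have "x \<notin> E n (B n)" using flip_iff by blast
    then have "\<not> unhappy G (B n) x" using s x by (simp add: E_def n_def)
    then have le: "card {z \<in> nbrs G x. (z \<in> B n) = (x \<in> B n)} \<le> card {z \<in> nbrs G x. (z \<in> B n) \<noteq> (x \<in> B n)}"
      by (simp only: unhappy_def not_less)
    have "{z \<in> nbrs G x. (z \<in> B n) = (x \<in> B n)} = {z \<in> nbrs G x. c x = c z}"
      "{z \<in> nbrs G x. (z \<in> B n) \<noteq> (x \<in> B n)} = {z \<in> nbrs G x. c x \<noteq> c z}"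
      using N[OF n] by (auto simp: c_def)
    then show "card {y \<in> nbrs G x. c x = c y} \<le> card {y \<in> nbrs G x. c x \<noteq> c y}" using le by simp
  qed
  ultimately show ?thesis by blast
qed

end
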